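(* Let $K$ be a field, $n\ge 1$, let $\mathcal{O}=\{t_1,\dots,t_\mu\}\subset\mathbb{T}^n$ be a (nonempty) order ideal and $\sigma$ a term ordering on $\mathbb{T}^n$. Then there exist a system $W$ of positive integer weights on the elements of $S_{c\mathcal{O},\sigma}$, a system $\overline{W}$ of positive integer weights on the elements of $S_{\mathcal{O},\sigma}$, and a system $V$ of positive integer weights on $x_1,\dots,x_n$ such that the following conditions hold. a) The system $\overline{W}$ is an extension of the system $W$ (they agree on $S_{c\mathcal{O},\sigma}\subseteq S_{\mathcal{O},\sigma}$). b) The ideal $I(\mathbb{G}_{\mathcal{O},\sigma})$ in $K[S_{c\mathcal{O},\sigma}]$ is $W$-homogeneous. c) The ideal $I(\mathbb{G}_{\mathcal{O},\sigma})+(g_1^*,\dots,g_\eta^* )$ in $K[\mathbf{x},S_{c\mathcal{O},\sigma}]$ is $(V,W)$-homogeneous. d) The image of $I(\mathbb{B}_{\mathcal{O}})$ in $K[S_{\mathcal{O},\sigma}]\cong K[\mathbf{c}]/L_{\mathcal{O},\sigma}$ is $\overline{W}$-homogeneous. e) The image of $I(\mathbb{B}_{\mathcal{O}})+(g_1^*,\dots,g_\nu^* )$ in $K[\mathbf{x},S_{\mathcal{O},\sigma}]\cong K[\mathbf{x},\mathbf{c}]/L_{\mathcal{O},\sigma}K[\mathbf{x},\mathbf{c}]$ is $(V,\overline{W})$-homogeneous.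
   Context: Notation: $P=K[x_1,\dots,x_n]$, $\mathbf{x}=x_1,\dots,x_n$, $\mathbb{T}^n=\{x_1^{\alpha_1}\cdots x_n^{\alpha_n}\mid\alpha_i\ge0\}$. An order ideal is a finite set $\mathcal{O}=\{t_1,\dots,t_\mu\}\subset\mathbb{T}^n$ (here nonempty) closed under taking divisors. Its border is $\partial\mathcal{O}=(x_1\mathcal{O}\cup\dots\cup x_n\mathcal{O})\setminus\mathcal{O}=\{b_1,\dots,b_\nu\}$. The corners $c\mathcal{O}\subseteq\partial\mathcal{O}$ are the minimal generators of the monoid ideal $\mathbb{T}^n\setminus\mathcal{O}$; the labelling is chosen so that $c\mathcal{O}=\{b_1,\dots,b_\eta\}$, $\eta\le\nu$. Let $\mathbf{c}=\{c_{ij}\mid 1\le i\le\mu,1\le j\le\nu\}$ be new indeterminates. Generic border prebasis: $g_j=b_j-\sum_{i=1}^\mu c_{ij}t_i$ for $j=1,\dots,\nu$. For $k=1,\dots,n$ the generic multiplication matrix $\mathcal{A}_k\in\mathrm{Mat}_\mu(K[\mathbf{c}])$ has $(i,j)$ entry $\delta_{im}$ if $x_kt_j=t_m\in\mathcal{O}$, and $c_{im}$ if $x_kt_j=b_m\in\partial\mathcal{O}$. $I(\mathbb{B}_{\mathcal{O}})\subseteq K[\mathbf{c}]$ is the ideal generated by all entries of all $\mathcal{A}_k\mathcal{A}_\ell-\mathcal{A}_\ell\mathcal{A}_k$, $1\le k<\ell\le n$. $S_{\mathcal{O},\sigma}=\{c_{ij}\mid b_j>_\sigma t_i\}$; $L_{\mathcal{O},\sigma}$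 is the ideal of $K[\mathbf{c}]$ generated by the $c_{ij}\notin S_{\mathcal{O},\sigma}$; $S_{c\mathcal{O},\sigma}=\{c_{ij}\in S_{\mathcal{O},\sigma}\mid j\le\eta\}$. The isomorphism $K[\mathbf{c}]/L_{\mathcal{O},\sigma}\cong K[S_{\mathcal{O},\sigma}]$ sets to zero all $c_{ij}\notin S_{\mathcal{O},\sigma}$. For $j=1,\dots,\nu$ let $g_j^*=b_j-\sum_{\{i\mid b_j>_\sigma t_i\}}c_{ij}t_i$. Finally $I(\mathbb{G}_{\mathcal{O},\sigma})=(L_{\mathcal{O},\sigma}+I(\mathbb{B}_{\mathcal{O}}))\cap K[S_{c\mathcal{O},\sigma}]$. A system of positive weights assigns to each indeterminate a positive integer degree. $W$-homogeneous means homogeneous for the grading in which each indeterminate has its assigned weight and $K$ has degree $0$; $(V,W)$-homogeneous means homogeneous for the $\mathbb{Z}$-grading where the $x_i$ have the weights given by $V$ and the $c_{ij}$ the weights given by $W$ (similarly $(V,\overline{W})$). *)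

theory Defs
  imports "HOL-Algebra.Ideal" "HOL-Library.Poly_Mapping" "Jordan_Normal_Form.Matrix"
begin

text \<open>
  All indices are 0-based: the indeterminates are \<open>x\<^sub>k\<close> with \<open>k < n\<close> and \<open>c\<^sub>i\<^sub>j\<close> with
  \<open>i < \<mu>\<close>, \<open>j < \<nu>\<close>.  A term is given by its exponent vector, so that the monoid of terms is
  written additively and the term \<open>1\<close> is the exponent vector \<open>0\<close>.
\<close>

type_synonym pp = "nat \<Rightarrow>\<^sub>0 nat"

definition terms :: "nat \<Rightarrow> pp set" where
  "terms n = {s. Poly_Mapping.keys s \<subseteq> {..<n}}"

definition term_divides :: "pp \<Rightarrow> pp \<Rightarrow> bool" where
  "term_divides s s' \<longleftrightarrow> (\<exists>u. s' = u + s)"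

definition order_ideal :: "nat \<Rightarrow> pp set \<Rightarrow> bool" where
  "order_ideal n Ord \<longleftrightarrow> finite Ord \<and> Ord \<noteq> {} \<and> Ord \<subseteq> terms n \<and>
     (\<forall>s\<in>Ord. \<forall>s'. term_divides s' s \<longrightarrow> s' \<in> Ord)"

abbreviation xterm :: "nat \<Rightarrow> pp" where
  "xterm k \<equiv> Poly_Mapping.single k 1"

definition border :: "nat \<Rightarrow> pp set \<Rightarrow> pp set" where
  "border n Ord = (\<Union>k<n. (\<lambda>s. xterm k + s) ` Ord) - Ord"

text \<open>A minimal generator of the monoid ideal of terms outside \<open>Ord\<close> is a term of this monoid
  ideal that is divisible by no other term of it.\<close>

definition corners :: "nat \<Rightarrow> pp set \<Rightarrow> pp set" where
  "corners n Ord = {s \<in> terms n - Ord. \<forall>u \<in> terms n - Ord. term_divides u s \<longrightarrow> u = s}"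

text \<open>\<open>(s, s') \<in> \<sigma>\<close> stands for \<open>s \<le> s'\<close>.\<close>

definition term_ordering :: "nat \<Rightarrow> pp rel \<Rightarrow> bool" where
  "term_ordering n \<sigma> \<longleftrightarrow> linear_order_on (terms n) \<sigma> \<and>
     (\<forall>s\<in>terms n. \<forall>s'\<in>terms n. \<forall>u\<in>terms n. (s, s') \<in> \<sigma> \<longrightarrow> (s + u, s' + u) \<in> \<sigma>) \<and>
     (\<forall>s\<in>terms n. (0, s) \<in> \<sigma>)"

definition term_less :: "pp rel \<Rightarrow> pp \<Rightarrow> pp \<Rightarrow> bool" where
  "term_less \<sigma> s s' \<longleftrightarrow> (s, s') \<in> \<sigma> \<and> s \<noteq> s'"


subsection \<open>Polynomial rings\<close>

text \<open>All polynomial rings of interest live inside one type, the polynomials in all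
  indeterminates \<open>Xvar k\<close> and \<open>Cvar i j\<close>; the ring \<open>K[S]\<close> for a set \<open>S\<close> of indeterminates is
  \<open>polys S\<close>.\<close>

datatype indet = Xvar nat | Cvar nat nat

type_synonym 'k mpoly = "(indet \<Rightarrow>\<^sub>0 nat) \<Rightarrow>\<^sub>0 'k"

definition polys :: "indet set \<Rightarrow> ('k::field) mpoly ring" where
  "polys S = \<lparr>carrier = {p. \<forall>m\<in>Poly_Mapping.keys p. Poly_Mapping.keys m \<subseteq> S},
              monoid.mult = (*), one = 1, zero = 0, add = (+)\<rparr>"

definition const_poly :: "'k \<Rightarrow> ('k::field) mpoly" where
  "const_poly a = Poly_Mapping.single 0 a"

definition var_poly :: "indet \<Rightarrow> ('k::field) mpoly" where
  "var_poly v = Poly_Mapping.single (Poly_Mapping.single v 1) 1"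

definition term_poly :: "pp \<Rightarrow> ('k::field) mpoly" where
  "term_poly s = (\<Prod>k\<in>Poly_Mapping.keys s. var_poly (Xvar k) ^ Poly_Mapping.lookup s k)"

text \<open>\<open>set_zero Z p\<close> substitutes \<open>0\<close> for the indeterminates in \<open>Z\<close>.\<close>

definition set_zero :: "indet set \<Rightarrow> ('k::field) mpoly \<Rightarrow> 'k mpoly" where
  "set_zero Z p = (\<Sum>m\<in>Poly_Mapping.keys p. const_poly (Poly_Mapping.lookup p m) *
      (\<Prod>v\<in>Poly_Mapping.keys m. (if v \<in> Z then 0 else var_poly v) ^ Poly_Mapping.lookup m v))"


subsection \<open>Gradings\<close>

definition weighted_degree :: "(indet \<Rightarrow> nat) \<Rightarrow> (indet \<Rightarrow>\<^sub>0 nat) \<Rightarrow> nat" where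
  "weighted_degree w m = (\<Sum>v\<in>Poly_Mapping.keys m. Poly_Mapping.lookup m v * w v)"

definition hom_component :: "(indet \<Rightarrow> nat) \<Rightarrow> nat \<Rightarrow> ('k::field) mpoly \<Rightarrow> 'k mpoly" where
  "hom_component w d p =
     (\<Sum>m\<in>{m \<in> Poly_Mapping.keys p. weighted_degree w m = d}. Poly_Mapping.single m (Poly_Mapping.lookup p m))"

text \<open>An ideal of \<open>K[S]\<close> is homogeneous if it is the direct sum of its intersections with the
  homogeneous parts of \<open>K[S]\<close>, i.e. contains the homogeneous components of its elements.\<close>

definition homogeneous_ideal :: "(indet \<Rightarrow> nat) \<Rightarrow> indet set \<Rightarrow> ('k::field) mpoly set \<Rightarrow> bool" where
  "homogeneous_ideal w S I \<longleftrightarrow> ideal I (polys S) \<and> (\<forall>p\<in>I. \<forall>d. hom_component w d p \<in> I)"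

text \<open>The weights \<open>V\<close> for the \<open>x\<^sub>k\<close> together with the weights \<open>W\<close> for the \<open>c\<^sub>i\<^sub>j\<close>.\<close>

definition joint_weights :: "(nat \<Rightarrow> nat) \<Rightarrow> (indet \<Rightarrow> nat) \<Rightarrow> indet \<Rightarrow> nat" where
  "joint_weights V W v = (case v of Xvar k \<Rightarrow> V k | Cvar i j \<Rightarrow> W v)"


subsection \<open>Border basis schemes and Groebner basis schemes\<close>

text \<open>In the following, \<open>t\<close> enumerates the order ideal by \<open>{..<\<mu>}\<close>, \<open>b\<close> enumerates its border by
  \<open>{..<\<nu>}\<close>, and the corners are \<open>b ` {..<\<eta>}\<close>.\<close>

definition x_vars :: "nat \<Rightarrow> indet set" where
  "x_vars n = {Xvar k | k. k < n}"

definition c_vars :: "nat \<Rightarrow> nat \<Rightarrow> indet set" where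
  "c_vars \<mu> \<nu> = {Cvar i j | i j. i < \<mu> \<and> j < \<nu>}"

text \<open>\<open>S_vars \<mu> \<nu> t b \<sigma>\<close> is \<open>S\<^sub>O\<^sub>,\<^sub>\<sigma>\<close>, and \<open>S_vars \<mu> \<eta> t b \<sigma>\<close> is \<open>S\<^sub>c\<^sub>O\<^sub>,\<^sub>\<sigma>\<close>.\<close>

definition S_vars :: "nat \<Rightarrow> nat \<Rightarrow> (nat \<Rightarrow> pp) \<Rightarrow> (nat \<Rightarrow> pp) \<Rightarrow> pp rel \<Rightarrow> indet set" where
  "S_vars \<mu> \<nu> t b \<sigma> = {Cvar i j | i j. i < \<mu> \<and> j < \<nu> \<and> term_less \<sigma> (t i) (b j)}"

definition generic_mult_mat ::
    "nat \<Rightarrow> nat \<Rightarrow> (nat \<Rightarrow> pp) \<Rightarrow> (nat \<Rightarrow> pp) \<Rightarrow> nat \<Rightarrow> ('k::field) mpoly mat" where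
  "generic_mult_mat \<mu> \<nu> t b k = Matrix.mat \<mu> \<mu> (\<lambda>(i, j).
     if xterm k + t j \<in> t ` {..<\<mu>} then (if xterm k + t j = t i then 1 else 0)
     else var_poly (Cvar i (THE m. m < \<nu> \<and> b m = xterm k + t j)))"

definition border_scheme_ideal ::
    "nat \<Rightarrow> nat \<Rightarrow> nat \<Rightarrow> (nat \<Rightarrow> pp) \<Rightarrow> (nat \<Rightarrow> pp) \<Rightarrow> ('k::field) mpoly set" where
  "border_scheme_ideal n \<mu> \<nu> t b = Idl\<^bsub>polys (c_vars \<mu> \<nu>)\<^esub>
     (\<Union>{elements_mat (generic_mult_mat \<mu> \<nu> t b k * generic_mult_mat \<mu> \<nu> t b l
                     - generic_mult_mat \<mu> \<nu> t b l * generic_mult_mat \<mu> \<nu> t b k)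
        | k l. k < l \<and> l < n})"

definition L_ideal ::
    "nat \<Rightarrow> nat \<Rightarrow> (nat \<Rightarrow> pp) \<Rightarrow> (nat \<Rightarrow> pp) \<Rightarrow> pp rel \<Rightarrow> ('k::field) mpoly set" where
  "L_ideal \<mu> \<nu> t b \<sigma> =
     Idl\<^bsub>polys (c_vars \<mu> \<nu>)\<^esub> (var_poly ` (c_vars \<mu> \<nu> - S_vars \<mu> \<nu> t b \<sigma>))"

definition groebner_scheme_ideal ::
    "nat \<Rightarrow> nat \<Rightarrow> nat \<Rightarrow> nat \<Rightarrow> (nat \<Rightarrow> pp) \<Rightarrow> (nat \<Rightarrow> pp) \<Rightarrow> pp rel \<Rightarrow> ('k::field) mpoly set" where
  "groebner_scheme_ideal n \<mu> \<nu> \<eta> t b \<sigma> =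
     (L_ideal \<mu> \<nu> t b \<sigma> <+>\<^bsub>polys (c_vars \<mu> \<nu>)\<^esub> border_scheme_ideal n \<mu> \<nu> t b)
     \<inter> carrier (polys (S_vars \<mu> \<eta> t b \<sigma>))"

definition g_star ::
    "nat \<Rightarrow> (nat \<Rightarrow> pp) \<Rightarrow> (nat \<Rightarrow> pp) \<Rightarrow> pp rel \<Rightarrow> nat \<Rightarrow> ('k::field) mpoly" where
  "g_star \<mu> t b \<sigma> j = term_poly (b j)
     - (\<Sum>i\<in>{i. i < \<mu> \<and> term_less \<sigma> (t i) (b j)}. var_poly (Cvar i j) * term_poly (t i))"

text \<open>The map \<open>K[x,c] \<rightarrow> K[x,c]/L K[x,c] \<cong> K[x,S]\<close>; on \<open>K[c]\<close> it is the map
  \<open>K[c] \<rightarrow> K[c]/L \<cong> K[S]\<close>.\<close>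

definition mod_L ::
    "nat \<Rightarrow> nat \<Rightarrow> (nat \<Rightarrow> pp) \<Rightarrow> (nat \<Rightarrow> pp) \<Rightarrow> pp rel \<Rightarrow> ('k::field) mpoly \<Rightarrow> 'k mpoly" where
  "mod_L \<mu> \<nu> t b \<sigma> = set_zero (c_vars \<mu> \<nu> - S_vars \<mu> \<nu> t b \<sigma>)"

text \<open>The sum of the extension of an ideal \<open>I\<close> (of a smaller polynomial ring) to \<open>K[S]\<close> and the
  ideal of \<open>K[S]\<close> generated by \<open>G\<close>.\<close>

definition extend_add :: "indet set \<Rightarrow> ('k::field) mpoly set \<Rightarrow> 'k mpoly set \<Rightarrow> 'k mpoly set" where
  "extend_add S I G = Idl\<^bsub>polys S\<^esub> I <+>\<^bsub>polys S\<^esub> Idl\<^bsub>polys S\<^esub> G"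

end

theory Submission
  imports Defs
begin

text \<open>
  All five statements come from one weight vector \<open>V\<close> on the \<open>x\<^sub>k\<close> that agrees with \<open>\<sigma>\<close> on the
  finitely many comparisons \<open>t\<^sub>i <\<^sub>\<sigma> b\<^sub>j\<close>, that is, such that the \<open>V\<close>-degree of \<open>b\<^sub>j\<close> exceeds that
  of \<open>t\<^sub>i\<close> whenever \<open>c\<^sub>i\<^sub>j\<close> belongs to \<open>S\<^sub>O\<^sub>,\<^sub>\<sigma>\<close>.  Such a vector exists by a theorem of the
  alternative: otherwise a product of terms \<open>b\<^sub>j\<close> (and \<open>x\<^sub>k\<close>) would coincide with a product of
  \<open>\<sigma>\<close>-smaller terms (\<open>positive_functional_exists\<close>, \<open>term_ordering_weights\<close>).

  The weight of \<open>c\<^sub>i\<^sub>j\<close> is the difference of the degrees of \<open>b\<^sub>j\<close> and \<open>t\<^sub>i\<close>.  It is positive on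
  \<open>S\<^sub>O\<^sub>,\<^sub>\<sigma>\<close> and makes each \<open>g\<^sub>j\<^sup>*\<close> homogeneous of the degree of \<open>b\<^sub>j\<close>.  After the
  indeterminates outside \<open>S\<^sub>O\<^sub>,\<^sub>\<sigma>\<close> are set to zero, the multiplication matrices are those of maps that
  raise degrees by \<open>V k\<close>; hence the entries of their commutators are homogeneous
  (\<open>mod_L_border_scheme_ideal_homogeneous\<close>), which gives (d).  The ideal of the Groebner basis
  scheme is the contraction of the ideal in (d) to fewer indeterminates
  (\<open>groebner_scheme_ideal_eq\<close>), which gives (b), since a component of a polynomial involves no new
  indeterminates.  Adjoining the \<open>g\<^sub>j\<^sup>*\<close> to these two ideals gives (c) and (e).

  Both the substitution of zero and the passage to a homogeneous component select some of the
  monomials of a polynomial.  They are studied together as \<open>restrict_monomials\<close>.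
\<close>

section \<open>Integer weights representing finitely many comparisons\<close>

lemma exists_strictly_between_finite_sets:
  fixes L U :: "'a::unbounded_dense_linorder set"
  assumes "finite L" "finite U" "\<And>l u. l \<in> L \<Longrightarrow> u \<in> U \<Longrightarrow> l < u"
  shows "\<exists>r. (\<forall>l\<in>L. l < r) \<and> (\<forall>u\<in>U. r < u)"
proof -
  consider "L = {}" "U = {}" | "L = {}" "U \<noteq> {}" | "L \<noteq> {}" "U = {}" | "L \<noteq> {}" "U \<noteq> {}"
    by blast
  then show ?thesis
  proof cases
    case 1
    then show ?thesis by simp
  next
    case 2
    obtain r where "r < Min U" using lt_ex by blast
    then show ?thesis using 2 assms by auto
  next
    case 3
    obtain r where "Max L < r" using gt_ex by blast
    then show ?thesis using 3 assms by auto
  next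
    case 4
    then have "Max L < Min U" using assms by simp
    then obtain r where "Max L < r" "r < Min U" using dense by blast
    then show ?thesis using 4 assms by auto
  qed
qed

lemma positive_multiple_closed:
  fixes C :: "(nat \<Rightarrow> int) set"
  assumes "\<And>u v. u \<in> C \<Longrightarrow> v \<in> C \<Longrightarrow> (\<lambda>k. u k + v k) \<in> C" "u \<in> C"
  shows "(\<lambda>k. int (Suc m) * u k) \<in> C"
proof (induction m)
  case 0
  then show ?case using assms by simp
next
  case (Suc m)
  have "(\<lambda>k. int (Suc (Suc m)) * u k) = (\<lambda>k. u k + int (Suc m) * u k)"
    by (simp add: algebra_simps)
  then show ?case using assms(1)[OF assms(2) Suc] by simp
qed

text \<open>
  This is Gordan's theorem of the alternative in the form needed for term orderings.  The induction
  is Fourier--Motzkin elimination of the last coordinate: vectors whose last coordinates have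
  opposite signs are combined to vectors with last coordinate zero, which stay in \<open>C\<close>.  A
  functional that is positive on the combinations leaves room for the last weight.
\<close>

lemma positive_functional_exists:
  fixes C D :: "(nat \<Rightarrow> int) set"
  assumes add: "\<And>u v. u \<in> C \<Longrightarrow> v \<in> C \<Longrightarrow> (\<lambda>k. u k + v k) \<in> C"
    and zero: "(\<lambda>_. 0) \<notin> C"
    and "finite D" "D \<subseteq> C" "\<And>d k. d \<in> D \<Longrightarrow> k \<ge> n \<Longrightarrow> d k = 0"
  shows "\<exists>V :: nat \<Rightarrow> int. \<forall>d\<in>D. 0 < (\<Sum>k<n. V k * d k)"
  using assms(3-)
proof (induction n arbitrary: D)
  case 0
  have "d = (\<lambda>_. 0)" if "d \<in> D" for d using 0(3)[OF that] by auto
  then show ?case using zero 0(2) by blast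
next
  case (Suc n)
  have scale: "(\<lambda>k. c * u k) \<in> C" if "c > 0" "u \<in> C" for c u
  proof -
    have "int (Suc (nat (c - 1))) = c" using that by simp
    moreover have "(\<lambda>k. int (Suc (nat (c - 1))) * u k) \<in> C"
      by (rule positive_multiple_closed[OF _ that(2)]) (rule add)
    ultimately show ?thesis by (simp only:)
  qed
  define comb where "comb d e = (\<lambda>k. d n * e k + (- e n) * d k)" for d e :: "nat \<Rightarrow> int"
  define D0 where "D0 = {d \<in> D. d n = 0}"
  define Dp where "Dp = {d \<in> D. d n > 0}"
  define Dm where "Dm = {d \<in> D. d n < 0}"
  define D' where "D' = D0 \<union> (\<lambda>(d, e). comb d e) ` (Dp \<times> Dm)"
  have "finite D'" using Suc(2) by (simp add: D'_def D0_def Dp_def Dm_def)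
  moreover have "D' \<subseteq> C"
  proof -
    have "comb d e \<in> C" if "d \<in> Dp" "e \<in> Dm" for d e
      unfolding comb_def using that Suc(3) by (intro add scale) (auto simp: Dp_def Dm_def)
    then show ?thesis using Suc(3) by (auto simp: D'_def D0_def)
  qed
  moreover have "d k = 0" if "d \<in> D'" "k \<ge> n" for d k
  proof (cases "k = n")
    case True
    then show ?thesis using that by (auto simp: D'_def D0_def comb_def)
  next
    case False
    then have zero_at: "d' k = 0" if "d' \<in> D" for d'
      using Suc(4)[OF that] \<open>k \<ge> n\<close> by simp
    consider "d \<in> D" | a e where "a \<in> D" "e \<in> D" "d = comb a e"
      using \<open>d \<in> D'\<close> by (auto simp: D'_def D0_def Dp_def Dm_def)
    then show ?thesis by cases (simp_all add: comb_def zero_at)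
  qed
  ultimately have "\<exists>V :: nat \<Rightarrow> int. \<forall>d\<in>D'. 0 < (\<Sum>k<n. V k * d k)" by (rule Suc(1))
  then obtain V :: "nat \<Rightarrow> int" where "\<forall>d\<in>D'. 0 < (\<Sum>k<n. V k * d k)" ..
  then have V: "0 < (\<Sum>k<n. V k * d k)" if "d \<in> D'" for d using that by (rule bspec)
  define f where "f d = (\<Sum>k<n. V k * d k)" for d :: "nat \<Rightarrow> int"
  have f_comb: "f (comb d e) = d n * f e - e n * f d" for d e
    unfolding f_def comb_def sum_distrib_left sum_subtractf[symmetric]
    by (intro sum.cong) (auto simp: algebra_simps)
  \<comment> \<open>A last weight \<open>r\<close> makes the functional positive at \<open>d\<close> iff \<open>r\<close> lies on the correct side of
    \<open>- f d / d n\<close>.\<close>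
  define q :: "(nat \<Rightarrow> int) \<Rightarrow> rat" where "q d = - of_int (f d) / of_int (d n)" for d
  have q_less: "q d < q e" if "d \<in> Dp" "e \<in> Dm" for d e
  proof -
    have "0 < f (comb d e)" unfolding f_def using that by (intro V) (auto simp: D'_def)
    then have "e n * f d < d n * f e" by (simp add: f_comb)
    then have "of_int (e n) * of_int (f d) < (of_int (d n) * of_int (f e) :: rat)"
      by (metis of_int_less_iff of_int_mult)
    moreover have "of_int (d n) > (0::rat)" "of_int (e n) < (0::rat)"
      using that by (auto simp: Dp_def Dm_def)
    ultimately show ?thesis by (simp add: q_def field_simps)
  qed
  have "\<exists>r. (\<forall>l\<in>q ` Dp. l < r) \<and> (\<forall>u\<in>q ` Dm. r < u)"
    by (rule exists_strictly_between_finite_sets) (use Suc(2) q_less in \<open>auto simp: Dp_def Dm_def\<close>)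
  then obtain r where "\<forall>l\<in>q ` Dp. l < r" "\<forall>u\<in>q ` Dm. r < u" by (elim exE conjE)
  then have r: "\<And>d. d \<in> Dp \<Longrightarrow> q d < r" "\<And>e. e \<in> Dm \<Longrightarrow> r < q e" by simp_all
  obtain a c where ac: "quotient_of r = (a, c)" by (cases "quotient_of r")
  have c: "c > 0" using quotient_of_denom_pos[OF ac] .
  have rac: "r = of_int a / of_int c" using quotient_of_div[OF ac] .
  \<comment> \<open>Clearing the denominator of \<open>r\<close> keeps the weights integral.\<close>
  define V' where "V' k = (if k < n then c * V k else a)" for k
  have eq: "(\<Sum>k<Suc n. V' k * d k) = c * f d + a * d n" for d
    by (simp add: V'_def f_def sum_distrib_left mult.assoc)
  have "0 < c * f d + a * d n" if "d \<in> D" for d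
  proof -
    have c': "of_int c > (0::rat)" using c by simp
    have "0 < of_int (f d) + r * of_int (d n)"
    proof -
      consider "d \<in> D0" | "d \<in> Dp" | "d \<in> Dm"
        using \<open>d \<in> D\<close> by (cases "d n" "0 :: int" rule: linorder_cases)
          (simp_all add: D0_def Dp_def Dm_def)
      then show ?thesis
      proof cases
        case 1
        then have "0 < f d" using V[of d] by (simp add: D'_def f_def)
        then show ?thesis using 1 by (simp add: D0_def)
      next
        case 2
        then have "of_int (d n) > (0::rat)" by (simp add: Dp_def)
        then show ?thesis using r(1)[OF 2] by (simp add: q_def field_simps)
      next
        case 3
        then have "of_int (d n) < (0::rat)" by (simp add: Dm_def)
        then show ?thesis using r(2)[OF 3] by (simp add: q_def field_simps)
      qed
    qed
    then have "0 < of_int c * (of_int (f d) + r * of_int (d n))" using c' by simp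
    also have "\<dots> = of_int (c * f d + a * d n)" using c' by (simp add: rac field_simps)
    finally show ?thesis by (simp only: of_int_0_less_iff)
  qed
  then show ?case using eq by metis
qed

definition term_degree :: "(nat \<Rightarrow> nat) \<Rightarrow> pp \<Rightarrow> nat" where
  "term_degree V s = (\<Sum>k\<in>Poly_Mapping.keys s. Poly_Mapping.lookup s k * V k)"

lemma term_degree_eq:
  "s \<in> terms n \<Longrightarrow> term_degree V s = (\<Sum>k<n. Poly_Mapping.lookup s k * V k)"
  unfolding term_degree_def terms_def by (rule sum.mono_neutral_left) (auto simp: in_keys_iff)

lemma terms_add: "s \<in> terms n \<Longrightarrow> s' \<in> terms n \<Longrightarrow> s + s' \<in> terms n"
  using keys_add[of s s'] by (auto simp: terms_def)

lemma xterm_in_terms: "k < n \<Longrightarrow> xterm k \<in> terms n"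
  by (simp add: terms_def)

lemma term_degree_xterm_plus:
  "term_degree V (xterm k + s) = V k + term_degree V s"
proof -
  obtain n where "\<forall>j\<in>Poly_Mapping.keys s \<union> {k}. j < n"
    using finite_nat_set_iff_bounded[of "Poly_Mapping.keys s \<union> {k}"] by auto
  then have n: "Poly_Mapping.keys s \<union> {k} \<subseteq> {..<n}" by auto
  then have st: "s \<in> terms n" by (simp add: terms_def)
  have xs: "xterm k + s \<in> terms n"
    using n by (intro terms_add xterm_in_terms st) auto
  have "(\<Sum>j<n. Poly_Mapping.lookup (xterm k) j * V j) = V k"
    using n by (simp add: lookup_single when_def if_distrib[of "\<lambda>c. c * _"] cong: if_cong)
  then show ?thesis
    unfolding term_degree_eq[OF st] term_degree_eq[OF xs]
    by (simp add: lookup_add distrib_right sum.distrib)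
qed

lemma term_less_add:
  assumes \<sigma>: "term_ordering n \<sigma>"
    and "s \<in> terms n" "s' \<in> terms n" "u \<in> terms n" "u' \<in> terms n"
    and "term_less \<sigma> s s'" "term_less \<sigma> u u'"
  shows "term_less \<sigma> (s + u) (s' + u')"
proof -
  have mono: "(a + c, b + c) \<in> \<sigma>"
    if "a \<in> terms n" "b \<in> terms n" "c \<in> terms n" "(a, b) \<in> \<sigma>" for a b c
    using \<sigma> that by (auto simp: term_ordering_def)
  have lin: "trans \<sigma>" "antisym \<sigma>"
    using \<sigma> by (auto simp: term_ordering_def linear_order_on_def partial_order_on_def preorder_on_def)
  have 1: "(s + u, s' + u) \<in> \<sigma>" using assms by (intro mono) (auto simp: term_less_def)
  have "(u + s', u' + s') \<in> \<sigma>" using assms by (intro mono) (auto simp: term_less_def)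
  then have 2: "(s' + u, s' + u') \<in> \<sigma>" by (simp add: add.commute)
  have "s + u \<noteq> s' + u'"
  proof
    assume "s + u = s' + u'"
    then have "s + u = s' + u" using 1 2 lin(2) by (metis antisymD)
    then show False using assms(6) by (simp add: term_less_def)
  qed
  then show ?thesis using 1 2 lin(1) by (auto simp: term_less_def dest: transD)
qed

text \<open>
  The differences \<open>s' - s\<close> with \<open>s <\<^sub>\<sigma> s'\<close> form a set of integer vectors that is closed under
  addition and does not contain zero, because a term ordering is compatible with multiplication.
  The comparisons \<open>1 <\<^sub>\<sigma> x\<^sub>k\<close> are thrown in to make the weights positive.
\<close>

lemma term_ordering_weights:
  assumes \<sigma>: "term_ordering n \<sigma>" and E: "finite E"
    "\<And>s s'. (s, s') \<in> E \<Longrightarrow> s \<in> terms n \<and> s' \<in> terms n \<and> term_less \<sigma> s s'"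
  shows "\<exists>V. (\<forall>k<n. 0 < V k) \<and> (\<forall>(s, s')\<in>E. term_degree V s < term_degree V s')"
proof -
  define diff :: "pp \<times> pp \<Rightarrow> nat \<Rightarrow> int"
    where "diff = (\<lambda>(s, s') k. int (Poly_Mapping.lookup s' k) - int (Poly_Mapping.lookup s k))"
  define R where "R = {(s, s'). s \<in> terms n \<and> s' \<in> terms n \<and> term_less \<sigma> s s'}"
  define D where "D = diff ` (E \<union> (\<lambda>k. (0, xterm k)) ` {..<n})"
  have zero_term: "0 \<in> terms n" by (simp add: terms_def)
  have "(0, xterm k) \<in> R" if "k < n" for k
  proof -
    have "xterm k \<noteq> 0" by (metis keys_single keys_zero insert_not_empty one_neq_zero)
    then show ?thesis using \<sigma> that zero_term xterm_in_terms[OF that]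
      by (auto simp: R_def term_less_def term_ordering_def)
  qed
  then have sub: "E \<union> (\<lambda>k. (0, xterm k)) ` {..<n} \<subseteq> R"
    using E(2) by (auto simp: R_def)
  have "\<exists>V :: nat \<Rightarrow> int. \<forall>d\<in>D. 0 < (\<Sum>k<n. V k * d k)"
  proof (rule positive_functional_exists[of "diff ` R"])
    fix u v assume "u \<in> diff ` R" "v \<in> diff ` R"
    then obtain s s' a a' where *: "(s, s') \<in> R" "(a, a') \<in> R" "u = diff (s, s')" "v = diff (a, a')"
      by auto
    then have "(s + a, s' + a') \<in> R"
      using term_less_add[OF \<sigma>] by (auto simp: R_def intro: terms_add)
    moreover have "(\<lambda>k. u k + v k) = diff (s + a, s' + a')"
      by (auto simp: * diff_def lookup_add)
    ultimately show "(\<lambda>k. u k + v k) \<in> diff ` R" by blast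
  next
    have "s = s'" if "diff (s, s') = (\<lambda>_. 0)" for s s'
      by (rule poly_mapping_eqI) (use fun_cong[OF that] in \<open>simp add: diff_def\<close>)
    then show "(\<lambda>_. 0) \<notin> diff ` R" by (auto simp: R_def term_less_def)
  next
    show "finite D" using E by (simp add: D_def)
    show "D \<subseteq> diff ` R" using sub by (auto simp: D_def)
    fix d k assume "d \<in> D" "k \<ge> n"
    then obtain s s' where *: "(s, s') \<in> R" "d = diff (s, s')" using sub by (auto simp: D_def)
    then have "k \<notin> Poly_Mapping.keys s" "k \<notin> Poly_Mapping.keys s'"
      using \<open>k \<ge> n\<close> by (auto simp: R_def terms_def)
    then show "d k = 0" using * by (simp add: diff_def in_keys_iff)
  qed
  then obtain V :: "nat \<Rightarrow> int" where "\<forall>d\<in>D. 0 < (\<Sum>k<n. V k * d k)" ..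
  then have V: "0 < (\<Sum>k<n. V k * d k)" if "d \<in> D" for d using that by (rule bspec)
  have pos: "0 < V k" if "k < n" for k
  proof -
    have "0 < (\<Sum>j<n. V j * diff (0, xterm k) j)" by (rule V) (use that in \<open>auto simp: D_def\<close>)
    also have "\<dots> = V k"
      using that by (simp add: diff_def lookup_single when_def if_distrib cong: if_cong)
    finally show ?thesis .
  qed
  have "term_degree (nat \<circ> V) s < term_degree (nat \<circ> V) s'" if "(s, s') \<in> E" for s s'
  proof -
    have deg: "int (term_degree (nat \<circ> V) u) = (\<Sum>k<n. V k * int (Poly_Mapping.lookup u k))"
      if "u \<in> terms n" for u
      unfolding term_degree_eq[OF that] using pos
      by (auto intro!: sum.cong simp: less_imp_le)
    have "0 < (\<Sum>k<n. V k * diff (s, s') k)" by (rule V) (use that in \<open>auto simp: D_def\<close>)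
    also have "\<dots> = int (term_degree (nat \<circ> V) s') - int (term_degree (nat \<circ> V) s)"
      using E(2)[OF that] by (simp add: deg diff_def sum_subtractf[symmetric] right_diff_distrib)
    finally show ?thesis by simp
  qed
  then show ?thesis using pos by (intro exI[of _ "nat \<circ> V"]) auto
qed

section \<open>Selecting monomials of a polynomial\<close>

definition restrict_monomials ::
    "((indet \<Rightarrow>\<^sub>0 nat) \<Rightarrow> bool) \<Rightarrow> ('k::field) mpoly \<Rightarrow> 'k mpoly" where
  "restrict_monomials P p =
     (\<Sum>m\<in>{m \<in> Poly_Mapping.keys p. P m}. Poly_Mapping.single m (Poly_Mapping.lookup p m))"

lemma lookup_restrict_monomials:
  "Poly_Mapping.lookup (restrict_monomials P p) m = (if P m then Poly_Mapping.lookup p m else 0)"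
  by (simp add: restrict_monomials_def lookup_sum lookup_single when_def in_keys_iff)

lemma keys_restrict_monomials:
  "Poly_Mapping.keys (restrict_monomials P p) = {m \<in> Poly_Mapping.keys p. P m}"
  by (auto simp: in_keys_iff lookup_restrict_monomials split: if_splits)

lemma restrict_monomials_add:
  "restrict_monomials P (p + q) = restrict_monomials P p + restrict_monomials P q"
  by (rule poly_mapping_eqI) (simp add: lookup_restrict_monomials lookup_add)

lemma restrict_monomials_zero: "restrict_monomials P 0 = 0"
  by (simp add: restrict_monomials_def)

lemma restrict_monomials_sum:
  "restrict_monomials P (sum f A) = (\<Sum>a\<in>A. restrict_monomials P (f a))"
  by (induction A rule: infinite_finite_induct)
    (auto simp: restrict_monomials_add restrict_monomials_zero)

lemma restrict_monomials_single:
  "restrict_monomials P (Poly_Mapping.single m c) = (if P m then Poly_Mapping.single m c else 0)"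
  by (rule poly_mapping_eqI) (auto simp: lookup_restrict_monomials lookup_single when_def)

lemma restrict_monomials_id:
  "(\<And>m. m \<in> Poly_Mapping.keys p \<Longrightarrow> P m) \<Longrightarrow> restrict_monomials P p = p"
  by (rule poly_mapping_eqI) (auto simp: lookup_restrict_monomials in_keys_iff)

lemma restrict_monomials_none:
  "(\<And>m. m \<in> Poly_Mapping.keys p \<Longrightarrow> \<not> P m) \<Longrightarrow> restrict_monomials P p = 0"
  by (rule poly_mapping_eqI) (auto simp: lookup_restrict_monomials in_keys_iff)

lemma sum_monomials:
  "(\<Sum>m\<in>Poly_Mapping.keys p. Poly_Mapping.single m (Poly_Mapping.lookup p m)) = p"
  by (rule poly_mapping_eqI) (simp add: lookup_sum lookup_single when_def in_keys_iff)

text \<open>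
  Multiplication by a monomial shifts the selection.  For a selection by degree or by the
  indeterminates that occur, the shifted selection is empty or again of the same kind, and so this
  one formula controls products both under the passage to a component and under the substitution of
  zero.
\<close>

lemma restrict_monomials_single_mult:
  "restrict_monomials P (Poly_Mapping.single m c * p)
     = Poly_Mapping.single m c * restrict_monomials (\<lambda>m'. P (m + m')) p"
proof -
  have "restrict_monomials P (Poly_Mapping.single m c * p)
      = (\<Sum>m'\<in>Poly_Mapping.keys p. restrict_monomials P
           (Poly_Mapping.single m c * Poly_Mapping.single m' (Poly_Mapping.lookup p m')))"
    by (simp only: restrict_monomials_sum[symmetric] sum_distrib_left[symmetric] sum_monomials)
  also have "\<dots> = (\<Sum>m'\<in>Poly_Mapping.keys p. Poly_Mapping.single m c *
      restrict_monomials (\<lambda>m'. P (m + m')) (Poly_Mapping.single m' (Poly_Mapping.lookup p m')))"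
    by (intro sum.cong) (auto simp: mult_single restrict_monomials_single)
  also have "\<dots> = Poly_Mapping.single m c * restrict_monomials (\<lambda>m'. P (m + m')) p"
    by (simp only: restrict_monomials_sum[symmetric] sum_distrib_left[symmetric] sum_monomials)
  finally show ?thesis .
qed

lemma restrict_monomials_mult_expand:
  "restrict_monomials P (r * p) = (\<Sum>m\<in>Poly_Mapping.keys r.
     Poly_Mapping.single m (Poly_Mapping.lookup r m) * restrict_monomials (\<lambda>m'. P (m + m')) p)"
  by (simp only: restrict_monomials_single_mult[symmetric] restrict_monomials_sum[symmetric]
      sum_distrib_right[symmetric] sum_monomials)

lemma keys_plus_indets:
  fixes m m' :: "indet \<Rightarrow>\<^sub>0 nat"
  shows "Poly_Mapping.keys (m + m') = Poly_Mapping.keys m \<union> Poly_Mapping.keys m'"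
  by (auto simp: in_keys_iff lookup_add)

lemma var_poly_power:
  "(var_poly v :: ('k::field) mpoly) ^ e = Poly_Mapping.single (Poly_Mapping.single v e) 1"
  by (induction e) (auto simp: var_poly_def mult_single single_add[symmetric])

lemma prod_single_one:
  "(\<Prod>v\<in>A. Poly_Mapping.single (f v) 1 :: ('k::field) mpoly) = Poly_Mapping.single (\<Sum>v\<in>A. f v) 1"
  by (induction A rule: infinite_finite_induct) (auto simp: mult_single)

lemma set_zero_eq_restrict_monomials:
  fixes p :: "('k::field) mpoly"
  shows "set_zero Z p = restrict_monomials (\<lambda>m. Poly_Mapping.keys m \<inter> Z = {}) p"
proof -
  have prod: "(\<Prod>v\<in>Poly_Mapping.keys m. (if v \<in> Z then 0 else var_poly v) ^ Poly_Mapping.lookup m v)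
      = (if Poly_Mapping.keys m \<inter> Z = {} then Poly_Mapping.single m 1 else 0 :: 'k mpoly)" for m
  proof (cases "Poly_Mapping.keys m \<inter> Z = {}")
    case True
    then have "(\<Prod>v\<in>Poly_Mapping.keys m.
          (if v \<in> Z then 0 else var_poly v :: 'k mpoly) ^ Poly_Mapping.lookup m v)
        = (\<Prod>v\<in>Poly_Mapping.keys m.
            Poly_Mapping.single (Poly_Mapping.single v (Poly_Mapping.lookup m v)) 1)"
      by (intro prod.cong) (auto simp: var_poly_power)
    also have "\<dots> = Poly_Mapping.single m 1" by (simp add: prod_single_one sum_monomials)
    finally show ?thesis using True by simp
  next
    case False
    then obtain v where "v \<in> Poly_Mapping.keys m" "v \<in> Z" by blast
    then have "\<exists>v\<in>Poly_Mapping.keys m.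
        (if v \<in> Z then 0 else var_poly v :: 'k mpoly) ^ Poly_Mapping.lookup m v = 0"
      by (intro bexI[of _ v]) (auto simp: in_keys_iff zero_power)
    then show ?thesis using False by (simp add: prod_zero)
  qed
  have "set_zero Z p = (\<Sum>m\<in>Poly_Mapping.keys p.
      restrict_monomials (\<lambda>m. Poly_Mapping.keys m \<inter> Z = {})
        (Poly_Mapping.single m (Poly_Mapping.lookup p m)))"
    unfolding set_zero_def
    by (intro sum.cong)
      (simp_all add: prod const_poly_def mult_single restrict_monomials_single)
  then show ?thesis by (simp add: restrict_monomials_sum[symmetric] sum_monomials)
qed

lemma hom_component_eq_restrict_monomials:
  "hom_component w d = restrict_monomials (\<lambda>m. weighted_degree w m = d)"
  by (rule ext) (simp add: hom_component_def restrict_monomials_def)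

lemma set_zero_add: "set_zero Z (p + q) = set_zero Z p + set_zero Z q"
  by (simp add: set_zero_eq_restrict_monomials restrict_monomials_add)

lemma set_zero_zero: "set_zero Z 0 = 0"
  by (simp add: set_zero_eq_restrict_monomials restrict_monomials_zero)

lemma set_zero_sum: "set_zero Z (sum f A) = (\<Sum>a\<in>A. set_zero Z (f a))"
  by (simp add: set_zero_eq_restrict_monomials restrict_monomials_sum)

lemma set_zero_diff: "set_zero Z (p - q) = set_zero Z p - set_zero Z q"
  using set_zero_add[of Z "p - q" q] by simp

lemma set_zero_mult:
  fixes p q :: "('k::field) mpoly"
  shows "set_zero Z (p * q) = set_zero Z p * set_zero Z q"
proof -
  let ?P = "\<lambda>m :: indet \<Rightarrow>\<^sub>0 nat. Poly_Mapping.keys m \<inter> Z = {}"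
  have "restrict_monomials ?P (p * q) = (\<Sum>m\<in>Poly_Mapping.keys p.
      restrict_monomials ?P (Poly_Mapping.single m (Poly_Mapping.lookup p m)) * restrict_monomials ?P q)"
    unfolding restrict_monomials_mult_expand
    by (intro sum.cong)
      (auto simp: restrict_monomials_single keys_plus_indets Int_Un_distrib2 restrict_monomials_none)
  then show ?thesis
    by (simp add: set_zero_eq_restrict_monomials sum_distrib_right[symmetric]
        restrict_monomials_sum[symmetric] sum_monomials)
qed

section \<open>Ideals of polynomial rings\<close>

lemma in_carrier_polys:
  "p \<in> carrier (polys S) \<longleftrightarrow> (\<forall>m\<in>Poly_Mapping.keys p. Poly_Mapping.keys m \<subseteq> S)"
  by (simp add: polys_def)

lemma polys_simps [simp]:
  "x \<otimes>\<^bsub>polys S\<^esub> y = x * y" "x \<oplus>\<^bsub>polys S\<^esub> y = x + y" "\<zero>\<^bsub>polys S\<^esub> = 0" "\<one>\<^bsub>polys S\<^esub> = 1"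
  by (simp_all add: polys_def)

lemma polys_mono: "S \<subseteq> T \<Longrightarrow> carrier (polys S) \<subseteq> carrier (polys T)"
  unfolding polys_def by auto

lemma polys_add_closed:
  "p \<in> carrier (polys S) \<Longrightarrow> q \<in> carrier (polys S) \<Longrightarrow> p + q \<in> carrier (polys S)"
  using keys_add[of p q] by (auto simp: in_carrier_polys)

lemma polys_mult_closed:
  assumes "p \<in> carrier (polys S)" "q \<in> carrier (polys S)"
  shows "p * q \<in> carrier (polys S)"
  using assms keys_mult[of p q] by (force simp: in_carrier_polys keys_plus_indets)

lemma polys_zero_closed: "0 \<in> carrier (polys S)"
  by (simp add: in_carrier_polys)

lemma polys_one_closed: "1 \<in> carrier (polys S)"
  by (simp add: in_carrier_polys)

lemma polys_uminus_closed: "p \<in> carrier (polys S) \<Longrightarrow> - p \<in> carrier (polys S)"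
  by (simp add: in_carrier_polys in_keys_iff)

lemma polys_diff_closed:
  "p \<in> carrier (polys S) \<Longrightarrow> q \<in> carrier (polys S) \<Longrightarrow> p - q \<in> carrier (polys S)"
  using polys_add_closed[OF _ polys_uminus_closed, of p S q] by simp

lemma polys_sum_closed:
  "(\<And>a. a \<in> A \<Longrightarrow> f a \<in> carrier (polys S)) \<Longrightarrow> sum f A \<in> carrier (polys S)"
  by (induction A rule: infinite_finite_induct) (auto intro: polys_add_closed polys_zero_closed)

lemma polys_power_closed: "p \<in> carrier (polys S) \<Longrightarrow> p ^ e \<in> carrier (polys S)"
  by (induction e) (auto intro: polys_mult_closed polys_one_closed)

lemma polys_prod_closed:
  "(\<And>a. a \<in> A \<Longrightarrow> f a \<in> carrier (polys S)) \<Longrightarrow> prod f A \<in> carrier (polys S)"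
  by (induction A rule: infinite_finite_induct) (auto intro: polys_mult_closed polys_one_closed)

lemma polys_var_closed: "v \<in> S \<Longrightarrow> var_poly v \<in> carrier (polys S)"
  by (simp add: in_carrier_polys var_poly_def)

lemma polys_monomial_closed:
  "p \<in> carrier (polys S) \<Longrightarrow> m \<in> Poly_Mapping.keys p \<Longrightarrow> Poly_Mapping.single m c \<in> carrier (polys S)"
  by (auto simp: in_carrier_polys)

lemma polys_restrict_closed:
  "p \<in> carrier (polys S) \<Longrightarrow> restrict_monomials P p \<in> carrier (polys S)"
  by (auto simp: in_carrier_polys keys_restrict_monomials)

lemma polys_cring: "cring (polys S :: ('k::field) mpoly ring)"
proof (rule cringI)
  show "abelian_group (polys S :: 'k mpoly ring)"
    by (rule abelian_groupI)
      (auto simp: algebra_simps intro: polys_add_closed polys_zero_closed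
        bexI[of _ "- _"] polys_uminus_closed)
  show "comm_monoid (polys S :: 'k mpoly ring)"
    by (rule comm_monoidI) (auto simp: algebra_simps intro: polys_mult_closed polys_one_closed)
qed (simp add: algebra_simps)

lemma polys_ring: "ring (polys S :: ('k::field) mpoly ring)"
  using polys_cring by (rule cring.axioms(1))

lemma ideal_polys_iff:
  fixes I :: "('k::field) mpoly set"
  shows "ideal I (polys S) \<longleftrightarrow> I \<subseteq> carrier (polys S) \<and> 0 \<in> I \<and>
    (\<forall>p\<in>I. \<forall>q\<in>I. p + q \<in> I) \<and> (\<forall>p\<in>I. \<forall>r\<in>carrier (polys S). r * p \<in> I)" (is "_ \<longleftrightarrow> ?R")
proof
  assume "ideal I (polys S)"
  then interpret ideal I "polys S" .
  have "0 \<in> I" using additive_subgroup.zero_closed[OF additive_subgroup_axioms] by simp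
  moreover have "p + q \<in> I" if "p \<in> I" "q \<in> I" for p q
    using additive_subgroup.a_closed[OF additive_subgroup_axioms that] by simp
  ultimately show ?R using a_subset I_l_closed by auto
next
  assume R: ?R
  interpret cring "polys S :: 'k mpoly ring" by (rule polys_cring)
  have neg: "- p \<in> I" if "p \<in> I" for p
    using R that polys_uminus_closed[OF polys_one_closed] by (metis mult_minus1)
  show "ideal I (polys S)"
  proof (rule idealI)
    show "subgroup I (add_monoid (polys S))"
    proof (rule add.subgroupI)
      fix a assume a: "a \<in> I"
      have "\<ominus>\<^bsub>polys S\<^esub> a = - a"
        by (rule minus_equality) (use a R neg in auto)
      then show "\<ominus>\<^bsub>polys S\<^esub> a \<in> I" using neg a by simp
    qed (use R in auto)
  qed (use R in \<open>auto simp: mult.commute intro: ring_axioms\<close>)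
qed

lemma genideal_polys_ideal:
  "G \<subseteq> carrier (polys S) \<Longrightarrow> ideal (Idl\<^bsub>polys S\<^esub> G) (polys S)"
  using polys_ring by (rule ring.genideal_ideal)

lemma genideal_polys_self: "G \<subseteq> carrier (polys S) \<Longrightarrow> G \<subseteq> Idl\<^bsub>polys S\<^esub> G"
  using polys_ring by (rule ring.genideal_self)

lemma genideal_polys_minimal:
  "ideal I (polys S) \<Longrightarrow> G \<subseteq> I \<Longrightarrow> Idl\<^bsub>polys S\<^esub> G \<subseteq> I"
  using polys_ring by (rule ring.genideal_minimal)

lemma ideal_sum_closed:
  "ideal I (polys S) \<Longrightarrow> (\<And>a. a \<in> A \<Longrightarrow> f a \<in> I) \<Longrightarrow> sum f A \<in> I"
  by (induction A rule: infinite_finite_induct) (auto simp: ideal_polys_iff)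

text \<open>As the ideal of a union of generators, the sum falls under the results on generated ideals.\<close>

lemma extend_add_eq_genideal:
  assumes "I \<subseteq> carrier (polys S)" "G \<subseteq> carrier (polys S)"
  shows "extend_add S I G = Idl\<^bsub>polys S\<^esub> (I \<union> G)"
proof
  let ?I = "Idl\<^bsub>polys S\<^esub> I" and ?G = "Idl\<^bsub>polys S\<^esub> G" and ?U = "Idl\<^bsub>polys S\<^esub> (I \<union> G)"
  have id: "ideal ?I (polys S)" "ideal ?G (polys S)" "ideal ?U (polys S)"
    using assms by (auto intro: genideal_polys_ideal)
  have "I \<union> G \<subseteq> ?U" using assms by (intro genideal_polys_self) auto
  then have "?I \<subseteq> ?U" "?G \<subseteq> ?U" using genideal_polys_minimal[OF id(3)] by auto
  moreover have "p + q \<in> ?U" if "p \<in> ?U" "q \<in> ?U" for p q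
    using id(3) that by (simp add: ideal_polys_iff)
  ultimately show "extend_add S I G \<subseteq> ?U"
    unfolding extend_add_def set_add_def' polys_simps by blast
  have "?I \<union> ?G \<subseteq> Idl\<^bsub>polys S\<^esub> (?I \<union> ?G)"
    using id by (intro genideal_polys_self) (auto simp: ideal_polys_iff)
  then have "I \<union> G \<subseteq> ?I <+>\<^bsub>polys S\<^esub> ?G"
    using genideal_polys_self[OF assms(1)] genideal_polys_self[OF assms(2)]
    unfolding ring.union_genideal[OF polys_ring id(1,2)] by blast
  then show "?U \<subseteq> extend_add S I G"
    unfolding extend_add_def
    by (rule genideal_polys_minimal[OF ring.add_ideals[OF polys_ring id(1,2)]])
qed

section \<open>Homogeneous ideals\<close>

lemma weighted_degree_add:
  "weighted_degree w (m + m') = weighted_degree w m + weighted_degree w m'"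
  unfolding weighted_degree_def by (rule setsum_keys_plus_distrib) (auto simp: algebra_simps)

lemma hom_component_mult:
  "hom_component w d (r * p) = (\<Sum>m\<in>Poly_Mapping.keys r.
     Poly_Mapping.single m (Poly_Mapping.lookup r m) *
     (if weighted_degree w m \<le> d then hom_component w (d - weighted_degree w m) p else 0))"
proof -
  have *: "restrict_monomials (\<lambda>m'. weighted_degree w m + weighted_degree w m' = d) p
      = (if weighted_degree w m \<le> d then hom_component w (d - weighted_degree w m) p else 0)" for m
  proof (cases "weighted_degree w m \<le> d")
    case True
    then have "(\<lambda>m'. weighted_degree w m + weighted_degree w m' = d)
        = (\<lambda>m'. weighted_degree w m' = d - weighted_degree w m)" by auto
    then show ?thesis using True by (simp add: hom_component_eq_restrict_monomials)
  next
    case False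
    then show ?thesis by (auto intro: restrict_monomials_none)
  qed
  show ?thesis
    unfolding hom_component_eq_restrict_monomials[of w d] restrict_monomials_mult_expand
    by (simp only: weighted_degree_add *)
qed

text \<open>
  The elements of an ideal all of whose components lie in the ideal form an ideal themselves; so
  homogeneity has to be tested on generators only.
\<close>

lemma homogeneous_genideal:
  fixes G :: "('k::field) mpoly set"
  assumes G: "G \<subseteq> carrier (polys S)"
    and comp: "\<And>g d. g \<in> G \<Longrightarrow> hom_component w d g \<in> Idl\<^bsub>polys S\<^esub> G"
  shows "homogeneous_ideal w S (Idl\<^bsub>polys S\<^esub> G)"
proof -
  let ?I = "Idl\<^bsub>polys S\<^esub> G"
  let ?J = "{p \<in> ?I. \<forall>d. hom_component w d p \<in> ?I}"
  have id: "ideal ?I (polys S)" by (rule genideal_polys_ideal[OF G])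
  have "hom_component w d (r * p) \<in> ?I" if r: "r \<in> carrier (polys S)" and p: "p \<in> ?J" for r p d
    unfolding hom_component_mult
  proof (rule ideal_sum_closed[OF id])
    fix m assume "m \<in> Poly_Mapping.keys r"
    then have "Poly_Mapping.single m (Poly_Mapping.lookup r m) \<in> carrier (polys S)"
      by (rule polys_monomial_closed[OF r])
    then show "Poly_Mapping.single m (Poly_Mapping.lookup r m) *
        (if weighted_degree w m \<le> d then hom_component w (d - weighted_degree w m) p else 0) \<in> ?I"
      using id p by (auto simp: ideal_polys_iff)
  qed
  then have "ideal ?J (polys S)"
    using id by (auto simp: ideal_polys_iff hom_component_eq_restrict_monomials
        restrict_monomials_zero restrict_monomials_add)
  then have "?I \<subseteq> ?J"
    by (rule genideal_polys_minimal) (use comp genideal_polys_self[OF G] in blast)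
  then show ?thesis using id by (auto simp: homogeneous_ideal_def)
qed

text \<open>
  The degree is an integer, because the natural degree of an entry of a generic multiplication
  matrix may be negative; the zero polynomial is homogeneous of every degree.
\<close>

definition homogeneous_poly :: "(indet \<Rightarrow> nat) \<Rightarrow> int \<Rightarrow> ('k::field) mpoly \<Rightarrow> bool" where
  "homogeneous_poly w D p \<longleftrightarrow> (\<forall>m\<in>Poly_Mapping.keys p. int (weighted_degree w m) = D)"

lemma hom_component_homogeneous_poly:
  "homogeneous_poly w D p \<Longrightarrow> hom_component w d p = (if int d = D then p else 0)"
  by (auto simp: homogeneous_poly_def hom_component_eq_restrict_monomials
      intro!: restrict_monomials_id restrict_monomials_none)

lemma homogeneous_poly_zero: "homogeneous_poly w D 0"
  by (simp add: homogeneous_poly_def)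

lemma homogeneous_poly_one: "homogeneous_poly w 0 1"
  by (simp add: homogeneous_poly_def weighted_degree_def)

lemma homogeneous_poly_var: "homogeneous_poly w (int (w v)) (var_poly v)"
  by (simp add: homogeneous_poly_def var_poly_def weighted_degree_def)

lemma homogeneous_poly_add:
  "homogeneous_poly w D p \<Longrightarrow> homogeneous_poly w D q \<Longrightarrow> homogeneous_poly w D (p + q)"
  using keys_add[of p q] by (auto simp: homogeneous_poly_def)

lemma homogeneous_poly_diff:
  "homogeneous_poly w D p \<Longrightarrow> homogeneous_poly w D q \<Longrightarrow> homogeneous_poly w D (p - q)"
  using homogeneous_poly_add[of w D p "- q"] by (simp add: homogeneous_poly_def in_keys_iff)

lemma homogeneous_poly_sum:
  "(\<And>a. a \<in> A \<Longrightarrow> homogeneous_poly w D (f a)) \<Longrightarrow> homogeneous_poly w D (sum f A)"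
  by (induction A rule: infinite_finite_induct)
    (auto intro: homogeneous_poly_add homogeneous_poly_zero)

lemma homogeneous_poly_mult:
  assumes "homogeneous_poly w D p" "homogeneous_poly w E q"
  shows "homogeneous_poly w (D + E) (p * q)"
  using assms keys_mult[of p q] by (force simp: homogeneous_poly_def weighted_degree_add)

lemma homogeneous_poly_power:
  "homogeneous_poly w D p \<Longrightarrow> homogeneous_poly w (int e * D) (p ^ e)"
  by (induction e)
    (auto simp: distrib_right intro: homogeneous_poly_one dest: homogeneous_poly_mult)

lemma homogeneous_poly_prod:
  "(\<And>a. a \<in> A \<Longrightarrow> homogeneous_poly w (D a) (f a)) \<Longrightarrow>
    homogeneous_poly w (sum D A) (prod f A)"
  by (induction A rule: infinite_finite_induct)
    (auto intro: homogeneous_poly_mult homogeneous_poly_one)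

lemma homogeneous_poly_term_poly:
  "homogeneous_poly (joint_weights V W) (int (term_degree V s)) (term_poly s)"
proof -
  have "homogeneous_poly (joint_weights V W)
      (\<Sum>k\<in>Poly_Mapping.keys s. int (Poly_Mapping.lookup s k) * int (joint_weights V W (Xvar k)))
      (term_poly s)"
    unfolding term_poly_def
    by (intro homogeneous_poly_prod homogeneous_poly_power homogeneous_poly_var)
  then show ?thesis by (simp add: term_degree_def joint_weights_def)
qed

lemma hom_component_cong:
  assumes "p \<in> carrier (polys S)" "\<And>v. v \<in> S \<Longrightarrow> w v = w' v"
  shows "hom_component w d p = hom_component w' d p"
proof -
  have "weighted_degree w m = weighted_degree w' m" if "m \<in> Poly_Mapping.keys p" for m
    unfolding weighted_degree_def
    by (rule sum.cong) (use assms that in \<open>auto simp: in_carrier_polys\<close>)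
  then have "{m \<in> Poly_Mapping.keys p. weighted_degree w m = d}
      = {m \<in> Poly_Mapping.keys p. weighted_degree w' m = d}" by auto
  then show ?thesis by (simp add: hom_component_def)
qed

section \<open>Ideals under the substitution of zero\<close>

lemma set_zero_closed:
  "p \<in> carrier (polys T) \<Longrightarrow> set_zero Z p \<in> carrier (polys (T - Z))"
  by (auto simp: set_zero_eq_restrict_monomials in_carrier_polys keys_restrict_monomials)

lemma set_zero_id: "p \<in> carrier (polys (T - Z)) \<Longrightarrow> set_zero Z p = p"
  unfolding set_zero_eq_restrict_monomials
  by (rule restrict_monomials_id) (auto simp: in_carrier_polys)

lemma set_zero_var: "set_zero Z (var_poly v) = (if v \<in> Z then 0 else var_poly v)"
  by (simp add: set_zero_eq_restrict_monomials var_poly_def restrict_monomials_single)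

lemma set_zero_one: "set_zero Z 1 = 1"
  by (rule set_zero_id[of _ UNIV]) (rule polys_one_closed)

text \<open>
  Substituting zero is a retraction of \<open>K[T]\<close> onto \<open>K[T - Z]\<close>; surjectivity is what makes the image
  of an ideal an ideal.
\<close>

lemma set_zero_genideal:
  fixes G :: "('k::field) mpoly set"
  assumes G: "G \<subseteq> carrier (polys T)"
  shows "set_zero Z ` (Idl\<^bsub>polys T\<^esub> G) = Idl\<^bsub>polys (T - Z)\<^esub> (set_zero Z ` G)"
proof
  let ?I = "Idl\<^bsub>polys T\<^esub> G" and ?J = "Idl\<^bsub>polys (T - Z)\<^esub> (set_zero Z ` G)"
  have I: "ideal ?I (polys T)" by (rule genideal_polys_ideal[OF G])
  have G': "set_zero Z ` G \<subseteq> carrier (polys (T - Z))" using G set_zero_closed by blast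
  have J: "ideal ?J (polys (T - Z))" by (rule genideal_polys_ideal[OF G'])
  have "ideal {p \<in> carrier (polys T). set_zero Z p \<in> ?J} (polys T)"
    using J unfolding ideal_polys_iff
    by (auto simp: set_zero_add set_zero_mult set_zero_zero set_zero_closed
        intro: polys_add_closed polys_mult_closed polys_zero_closed)
  then have "?I \<subseteq> {p \<in> carrier (polys T). set_zero Z p \<in> ?J}"
    by (rule genideal_polys_minimal) (use G genideal_polys_self[OF G'] in auto)
  then show "set_zero Z ` ?I \<subseteq> ?J" by blast
  have "ideal (set_zero Z ` ?I) (polys (T - Z))"
    unfolding ideal_polys_iff
  proof (intro conjI ballI)
    show "set_zero Z ` ?I \<subseteq> carrier (polys (T - Z))"
      using I set_zero_closed by (auto simp: ideal_polys_iff)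
    show "0 \<in> set_zero Z ` ?I"
      using I set_zero_zero[of Z] unfolding ideal_polys_iff by (metis image_eqI)
  next
    fix p q assume "p \<in> set_zero Z ` ?I" "q \<in> set_zero Z ` ?I"
    then show "p + q \<in> set_zero Z ` ?I"
      using I by (auto simp: ideal_polys_iff set_zero_add[symmetric])
  next
    fix p r :: "'k mpoly" assume "p \<in> set_zero Z ` ?I" and r: "r \<in> carrier (polys (T - Z))"
    then obtain p' where p': "p' \<in> ?I" "p = set_zero Z p'" by blast
    have "r \<in> carrier (polys T)" using r polys_mono[of "T - Z" T] by blast
    then have "r * p' \<in> ?I" using I p' by (simp add: ideal_polys_iff)
    moreover have "r * p = set_zero Z (r * p')" using set_zero_id[OF r] p' by (simp add: set_zero_mult)
    ultimately show "r * p \<in> set_zero Z ` ?I" by blast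
  qed
  then show "?J \<subseteq> set_zero Z ` ?I"
    by (rule genideal_polys_minimal) (use genideal_polys_self[OF G] in blast)
qed

text \<open>
  Each monomial that is dropped is a multiple of an indeterminate in \<open>Z\<close>; so substituting zero
  does not change the residue class modulo these indeterminates.
\<close>

lemma diff_set_zero_in_genideal:
  fixes p :: "('k::field) mpoly"
  assumes p: "p \<in> carrier (polys T)" and Z: "Z \<subseteq> T"
  shows "set_zero Z p - p \<in> Idl\<^bsub>polys T\<^esub> (var_poly ` Z)"
proof -
  let ?I = "Idl\<^bsub>polys T\<^esub> (var_poly ` Z) :: 'k mpoly set"
  have sub: "var_poly ` Z \<subseteq> carrier (polys T :: 'k mpoly ring)"
    using Z by (auto intro: polys_var_closed)
  have id: "ideal ?I (polys T)" by (rule genideal_polys_ideal[OF sub])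
  have "set_zero Z p - p = (\<Sum>m\<in>Poly_Mapping.keys p.
      set_zero Z (Poly_Mapping.single m (Poly_Mapping.lookup p m))
        - Poly_Mapping.single m (Poly_Mapping.lookup p m))"
    by (simp only: sum_subtractf set_zero_sum[symmetric] sum_monomials)
  also have "\<dots> \<in> ?I"
  proof (rule ideal_sum_closed[OF id])
    fix m assume m: "m \<in> Poly_Mapping.keys p"
    show "set_zero Z (Poly_Mapping.single m (Poly_Mapping.lookup p m))
        - Poly_Mapping.single m (Poly_Mapping.lookup p m) \<in> ?I"
    proof (cases "Poly_Mapping.keys m \<inter> Z = {}")
      case True
      then show ?thesis
        using id by (simp add: set_zero_eq_restrict_monomials restrict_monomials_single ideal_polys_iff)
    next
      case False
      then obtain v where v: "v \<in> Poly_Mapping.keys m" "v \<in> Z" by blast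
      define m' where "m' = m - Poly_Mapping.single v 1"
      have mm: "m = m' + Poly_Mapping.single v 1"
        unfolding m'_def
        by (rule poly_mapping_eqI)
          (use v in \<open>auto simp: lookup_add lookup_minus lookup_single when_def in_keys_iff\<close>)
      have "Poly_Mapping.keys m \<subseteq> T" using p m by (simp add: in_carrier_polys)
      then have "Poly_Mapping.keys m' \<subseteq> T" by (subst (asm) mm) (simp add: keys_plus_indets)
      then have r: "Poly_Mapping.single m' (- Poly_Mapping.lookup p m) \<in> carrier (polys T)"
        by (auto simp: in_carrier_polys)
      have "var_poly v \<in> ?I" using genideal_polys_self[OF sub] v by blast
      then have "Poly_Mapping.single m' (- Poly_Mapping.lookup p m) * var_poly v \<in> ?I"
        using id r by (simp add: ideal_polys_iff)
      then show ?thesis using False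
        unfolding var_poly_def mult_single mm[symmetric]
        by (simp add: set_zero_eq_restrict_monomials restrict_monomials_single single_uminus)
    qed
  qed
  finally show ?thesis .
qed

text \<open>
  Each residue class modulo the indeterminates in \<open>Z\<close> has a unique representative free of \<open>Z\<close>, the
  result of the substitution.
\<close>

lemma variable_ideal_sum_contraction:
  fixes B :: "('k::field) mpoly set"
  assumes Z: "Z \<subseteq> T" and B: "ideal B (polys T)"
  shows "((Idl\<^bsub>polys T\<^esub> (var_poly ` Z)) <+>\<^bsub>polys T\<^esub> B) \<inter> carrier (polys (T - Z)) = set_zero Z ` B"
proof -
  let ?L = "Idl\<^bsub>polys T\<^esub> (var_poly ` Z) :: 'k mpoly set"
  have sub: "var_poly ` Z \<subseteq> carrier (polys T :: 'k mpoly ring)"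
    using Z by (auto intro: polys_var_closed)
  have "ideal {0 :: 'k mpoly} (polys (T - Z))" by (auto simp: ideal_polys_iff polys_zero_closed)
  then have "Idl\<^bsub>polys (T - Z)\<^esub> (set_zero Z ` (var_poly ` Z :: 'k mpoly set)) \<subseteq> {0}"
    by (rule genideal_polys_minimal) (auto simp: set_zero_var)
  then have kill: "set_zero Z l = 0" if "l \<in> ?L" for l
    using that unfolding set_zero_genideal[OF sub, of Z, symmetric] by blast
  show ?thesis
  proof
    show "(?L <+>\<^bsub>polys T\<^esub> B) \<inter> carrier (polys (T - Z)) \<subseteq> set_zero Z ` B"
    proof
      fix p assume "p \<in> (?L <+>\<^bsub>polys T\<^esub> B) \<inter> carrier (polys (T - Z))"
      then obtain l q where *: "l \<in> ?L" "q \<in> B" "p = l + q" and p: "p \<in> carrier (polys (T - Z))"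
        by (auto simp: set_add_def')
      have "p = set_zero Z q" using set_zero_id[OF p] * by (simp add: set_zero_add kill)
      then show "p \<in> set_zero Z ` B" using * by blast
    qed
    show "set_zero Z ` B \<subseteq> (?L <+>\<^bsub>polys T\<^esub> B) \<inter> carrier (polys (T - Z))"
    proof
      fix p assume "p \<in> set_zero Z ` B"
      then obtain q where q: "q \<in> B" "p = set_zero Z q" by blast
      then have qT: "q \<in> carrier (polys T)" using B by (auto simp: ideal_polys_iff)
      have "p = (p - q) + q" by simp
      moreover have "p - q \<in> ?L" using diff_set_zero_in_genideal[OF qT Z] q by simp
      ultimately have "p \<in> ?L <+>\<^bsub>polys T\<^esub> B" using q(1) unfolding set_add_def' by force
      then show "p \<in> (?L <+>\<^bsub>polys T\<^esub> B) \<inter> carrier (polys (T - Z))"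
        using set_zero_closed[OF qT] q by blast
    qed
  qed
qed

lemma set_zero_extend_add:
  assumes "I \<subseteq> carrier (polys T)" "G \<subseteq> carrier (polys T)"
  shows "set_zero Z ` extend_add T I G = extend_add (T - Z) (set_zero Z ` I) (set_zero Z ` G)"
proof -
  have "set_zero Z ` I \<subseteq> carrier (polys (T - Z))" "set_zero Z ` G \<subseteq> carrier (polys (T - Z))"
    using assms set_zero_closed by blast+
  then show ?thesis
    using assms by (simp add: extend_add_eq_genideal set_zero_genideal image_Un)
qed

text \<open>
  The components of an element of \<open>I\<close> stay in \<open>I\<close> when the weights are extended to further
  indeterminates; so \<open>I \<union> G\<close> meets the test on generators.
\<close>

lemma homogeneous_extend_add:
  assumes I: "homogeneous_ideal w' S' I" and S: "S' \<subseteq> S" "\<And>v. v \<in> S' \<Longrightarrow> w v = w' v"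
    and G: "G \<subseteq> carrier (polys S)" "\<And>g. g \<in> G \<Longrightarrow> \<exists>D. homogeneous_poly w D g"
  shows "homogeneous_ideal w S (extend_add S I G)"
proof -
  have I': "I \<subseteq> carrier (polys S')"
    using I by (auto simp: homogeneous_ideal_def ideal_polys_iff)
  then have IS: "I \<subseteq> carrier (polys S)" using polys_mono[OF S(1)] by blast
  have sub: "I \<union> G \<subseteq> carrier (polys S)" using IS G(1) by blast
  have "hom_component w d g \<in> Idl\<^bsub>polys S\<^esub> (I \<union> G)" if "g \<in> I \<union> G" for g d
  proof (cases "g \<in> I")
    case True
    then have "hom_component w d g = hom_component w' d g"
      using I' S(2) by (intro hom_component_cong[of _ S']) auto
    also have "\<dots> \<in> I" using I True by (auto simp: homogeneous_ideal_def)
    finally show ?thesis using genideal_polys_self[OF sub] by blast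
  next
    case False
    then have "g \<in> G" using that by blast
    from G(2)[OF this] obtain D where "homogeneous_poly w D g" ..
    then have "hom_component w d g \<in> {0, g}" by (simp add: hom_component_homogeneous_poly)
    then show ?thesis
      using genideal_polys_self[OF sub] genideal_polys_ideal[OF sub] that
      by (auto simp: ideal_polys_iff)
  qed
  then show ?thesis
    unfolding extend_add_eq_genideal[OF IS G(1)] by (rule homogeneous_genideal[OF sub])
qed

lemma homogeneous_contraction:
  assumes I: "homogeneous_ideal w S I" and S: "S' \<subseteq> S"
  shows "homogeneous_ideal w S' (I \<inter> carrier (polys S'))"
  using I polys_mono[OF S] unfolding homogeneous_ideal_def ideal_polys_iff
  by (auto intro: polys_add_closed polys_mult_closed polys_zero_closed polys_restrict_closed
      simp: hom_component_eq_restrict_monomials)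

section \<open>Weights of the coefficient indeterminates\<close>

text \<open>
  These weights give every term of \<open>g\<^sub>j\<^sup>*\<close> the degree of \<open>b\<^sub>j\<close>.  The subtraction is truncated, and
  so the value is meaningful only for an indeterminate whose border term has the larger degree.
\<close>

definition coefficient_weight ::
    "(nat \<Rightarrow> nat) \<Rightarrow> (nat \<Rightarrow> pp) \<Rightarrow> (nat \<Rightarrow> pp) \<Rightarrow> indet \<Rightarrow> nat" where
  "coefficient_weight V t b v =
     (case v of Xvar k \<Rightarrow> 0 | Cvar i j \<Rightarrow> term_degree V (b j) - term_degree V (t i))"

lemma term_poly_closed: "s \<in> terms n \<Longrightarrow> x_vars n \<subseteq> S \<Longrightarrow> term_poly s \<in> carrier (polys S)"
  unfolding term_poly_def
  by (intro polys_prod_closed polys_power_closed polys_var_closed)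
    (auto simp: terms_def x_vars_def)

lemma g_star_closed:
  assumes "j < N" "b j \<in> terms n" "\<And>i. i < \<mu> \<Longrightarrow> t i \<in> terms n"
  shows "g_star \<mu> t b \<sigma> j \<in> carrier (polys (x_vars n \<union> S_vars \<mu> N t b \<sigma>))"
  unfolding g_star_def using assms
  by (intro polys_diff_closed polys_sum_closed polys_mult_closed polys_var_closed
      term_poly_closed[of _ n]) (auto simp: S_vars_def)

lemma g_star_homogeneous:
  assumes "\<And>i. i < \<mu> \<Longrightarrow> term_less \<sigma> (t i) (b j) \<Longrightarrow> term_degree V (t i) \<le> term_degree V (b j)"
  shows "homogeneous_poly (joint_weights V (coefficient_weight V t b))
    (int (term_degree V (b j))) (g_star \<mu> t b \<sigma> j)"
  unfolding g_star_def
proof (intro homogeneous_poly_diff homogeneous_poly_term_poly homogeneous_poly_sum)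
  fix i assume "i \<in> {i. i < \<mu> \<and> term_less \<sigma> (t i) (b j)}"
  then have le: "term_degree V (t i) \<le> term_degree V (b j)" using assms by blast
  let ?w = "joint_weights V (coefficient_weight V t b)"
  have "homogeneous_poly ?w (int (?w (Cvar i j)) + int (term_degree V (t i)))
      (var_poly (Cvar i j) * term_poly (t i))"
    by (intro homogeneous_poly_mult homogeneous_poly_var homogeneous_poly_term_poly)
  then show "homogeneous_poly ?w (int (term_degree V (b j))) (var_poly (Cvar i j) * term_poly (t i))"
    using le by (simp add: joint_weights_def coefficient_weight_def)
qed

lemma border_index:
  assumes t: "bij_betw t {..<\<mu>} Ord" and b: "bij_betw b {..<\<nu>} (border n Ord)"
    and "k < n" "j < \<mu>" "xterm k + t j \<notin> t ` {..<\<mu>}"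
  obtains m where "m < \<nu>" "b m = xterm k + t j" "(THE m. m < \<nu> \<and> b m = xterm k + t j) = m"
proof -
  have "xterm k + t j \<in> border n Ord"
    using assms(3-5) bij_betw_imp_surj_on[OF t] by (auto simp: border_def)
  then obtain m where m: "m < \<nu>" "b m = xterm k + t j"
    using bij_betw_imp_surj_on[OF b] by (metis imageE lessThan_iff)
  moreover have "(THE m. m < \<nu> \<and> b m = xterm k + t j) = m"
    using m bij_betw_imp_inj_on[OF b] by (intro the_equality) (auto simp: inj_on_def)
  ultimately show ?thesis by (rule that)
qed

lemma generic_mult_mat_closed:
  assumes "bij_betw t {..<\<mu>} Ord" "bij_betw b {..<\<nu>} (border n Ord)" "k < n" "i < \<mu>" "j < \<mu>"
  shows "generic_mult_mat \<mu> \<nu> t b k $$ (i, j) \<in> (carrier (polys (c_vars \<mu> \<nu>)) :: ('k::field) mpoly set)"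
proof (cases "xterm k + t j \<in> t ` {..<\<mu>}")
  case True
  then show ?thesis
    using assms by (simp add: generic_mult_mat_def polys_one_closed polys_zero_closed)
next
  case False
  obtain m where m: "m < \<nu>" "(THE m. m < \<nu> \<and> b m = xterm k + t j) = m"
    using border_index[OF assms(1,2,3,5) False] by blast
  have "generic_mult_mat \<mu> \<nu> t b k $$ (i, j) = (var_poly (Cvar i m) :: 'k mpoly)"
    using False assms m by (simp add: generic_mult_mat_def)
  moreover have "Cvar i m \<in> c_vars \<mu> \<nu>" using m(1) assms(4) by (simp add: c_vars_def)
  ultimately show ?thesis by (simp add: polys_var_closed)
qed

text \<open>
  Multiplication by \<open>x\<^sub>k\<close> is a map of degree \<open>V k\<close> on the span of the order ideal: an entry of its
  matrix that survives the substitution has as degree the difference between \<open>x\<^sub>k t\<^sub>j\<close> and \<open>t\<^sub>i\<close>.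
\<close>

lemma mod_L_generic_mult_mat_homogeneous:
  assumes "bij_betw t {..<\<mu>} Ord" "bij_betw b {..<\<nu>} (border n Ord)" "k < n" "i < \<mu>" "j < \<mu>"
    and le: "\<And>i m. i < \<mu> \<Longrightarrow> m < \<nu> \<Longrightarrow> term_less \<sigma> (t i) (b m) \<Longrightarrow>
      term_degree V (t i) \<le> term_degree V (b m)"
  shows "homogeneous_poly (coefficient_weight V t b)
    (int (V k) + int (term_degree V (t j)) - int (term_degree V (t i)))
    (mod_L \<mu> \<nu> t b \<sigma> (generic_mult_mat \<mu> \<nu> t b k $$ (i, j)))"
proof (cases "xterm k + t j \<in> t ` {..<\<mu>}")
  case in_Ord: True
  show ?thesis
  proof (cases "xterm k + t j = t i")
    case True
    then have "int (V k) + int (term_degree V (t j)) - int (term_degree V (t i)) = 0"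
      using term_degree_xterm_plus[of V k "t j"] by simp
    then show ?thesis
      using in_Ord True assms(4,5)
      by (simp add: generic_mult_mat_def mod_L_def set_zero_one homogeneous_poly_one)
  next
    case False
    then show ?thesis
      using in_Ord assms(4,5)
      by (simp add: generic_mult_mat_def mod_L_def set_zero_zero homogeneous_poly_zero)
  qed
next
  case False
  obtain m where m: "m < \<nu>" "b m = xterm k + t j" "(THE m. m < \<nu> \<and> b m = xterm k + t j) = m"
    using border_index[OF assms(1,2,3,5) False] .
  have entry: "generic_mult_mat \<mu> \<nu> t b k $$ (i, j) = var_poly (Cvar i m)"
    using False assms(4,5) m by (simp add: generic_mult_mat_def)
  show ?thesis
  proof (cases "term_less \<sigma> (t i) (b m)")
    case True
    then have "Cvar i m \<notin> c_vars \<mu> \<nu> - S_vars \<mu> \<nu> t b \<sigma>"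
      using m(1) assms(4) by (auto simp: S_vars_def)
    moreover have "int (coefficient_weight V t b (Cvar i m))
        = int (V k) + int (term_degree V (t j)) - int (term_degree V (t i))"
      using le[OF assms(4) m(1) True] term_degree_xterm_plus[of V k "t j"] m(2)
      by (simp add: coefficient_weight_def)
    ultimately show ?thesis
      using homogeneous_poly_var[of "coefficient_weight V t b" "Cvar i m"]
      unfolding entry mod_L_def set_zero_var by (simp only: if_False)
  next
    case False
    then have "Cvar i m \<in> c_vars \<mu> \<nu> - S_vars \<mu> \<nu> t b \<sigma>"
      using m(1) assms(4) by (auto simp: S_vars_def c_vars_def)
    then show ?thesis by (simp add: entry mod_L_def set_zero_var homogeneous_poly_zero)
  qed
qed

lemma generic_commutator_entry:
  assumes "i < \<mu>" "j < \<mu>"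
  shows "(generic_mult_mat \<mu> \<nu> t b k * generic_mult_mat \<mu> \<nu> t b l
       - generic_mult_mat \<mu> \<nu> t b l * generic_mult_mat \<mu> \<nu> t b k) $$ (i, j)
     = (\<Sum>m<\<mu>. generic_mult_mat \<mu> \<nu> t b k $$ (i, m) * generic_mult_mat \<mu> \<nu> t b l $$ (m, j))
     - (\<Sum>m<\<mu>. generic_mult_mat \<mu> \<nu> t b l $$ (i, m) * generic_mult_mat \<mu> \<nu> t b k $$ (m, j))"
proof -
  have dim: "dim_row (generic_mult_mat \<mu> \<nu> t b k) = \<mu>" "dim_col (generic_mult_mat \<mu> \<nu> t b k) = \<mu>"
    for k by (simp_all add: generic_mult_mat_def)
  show ?thesis using assms by (simp add: dim scalar_prod_def lessThan_atLeast0)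
qed

lemma border_scheme_ideal_generators:
  "border_scheme_ideal n \<mu> \<nu> t b = Idl\<^bsub>polys (c_vars \<mu> \<nu>)\<^esub>
     {(generic_mult_mat \<mu> \<nu> t b k * generic_mult_mat \<mu> \<nu> t b l
       - generic_mult_mat \<mu> \<nu> t b l * generic_mult_mat \<mu> \<nu> t b k) $$ (i, j)
      | k l i j. k < l \<and> l < n \<and> i < \<mu> \<and> j < \<mu>}"
proof -
  have elements: "elements_mat M = {M $$ (i, j) | i j. i < dim_row M \<and> j < dim_col M}"
    for M :: "'a mpoly mat"
    unfolding elements_mat_def by force
  have dim: "dim_row (generic_mult_mat \<mu> \<nu> t b k :: 'a mpoly mat) = \<mu>"
    "dim_col (generic_mult_mat \<mu> \<nu> t b k :: 'a mpoly mat) = \<mu>" for k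
    by (simp_all add: generic_mult_mat_def)
  show ?thesis
    unfolding border_scheme_ideal_def elements index_minus_mat(2,3)
      index_mult_mat(2,3) dim
    by (intro arg_cong[where f = "genideal _"]) blast
qed

lemma border_scheme_generators_closed:
  assumes "bij_betw t {..<\<mu>} Ord" "bij_betw b {..<\<nu>} (border n Ord)"
  shows "{(generic_mult_mat \<mu> \<nu> t b k * generic_mult_mat \<mu> \<nu> t b l
       - generic_mult_mat \<mu> \<nu> t b l * generic_mult_mat \<mu> \<nu> t b k) $$ (i, j)
      | k l i j. k < l \<and> l < n \<and> i < \<mu> \<and> j < \<mu>} \<subseteq> carrier (polys (c_vars \<mu> \<nu>))"
  by (auto simp only: generic_commutator_entry lessThan_iff intro!: polys_diff_closed
      polys_sum_closed polys_mult_closed generic_mult_mat_closed[OF assms])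

lemma border_scheme_ideal_is_ideal:
  assumes "bij_betw t {..<\<mu>} Ord" "bij_betw b {..<\<nu>} (border n Ord)"
  shows "ideal (border_scheme_ideal n \<mu> \<nu> t b) (polys (c_vars \<mu> \<nu>))"
  unfolding border_scheme_ideal_generators
  by (rule genideal_polys_ideal[OF border_scheme_generators_closed[OF assms]])

text \<open>
  Both products in a commutator have degree \<open>V k + V l\<close> as maps, and hence their entries at the
  same position have equal degree.
\<close>

lemma mod_L_border_scheme_ideal_homogeneous:
  assumes bij: "bij_betw t {..<\<mu>} Ord" "bij_betw b {..<\<nu>} (border n Ord)"
    and le: "\<And>i m. i < \<mu> \<Longrightarrow> m < \<nu> \<Longrightarrow> term_less \<sigma> (t i) (b m) \<Longrightarrow>
      term_degree V (t i) \<le> term_degree V (b m)"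
  shows "homogeneous_ideal (coefficient_weight V t b) (S_vars \<mu> \<nu> t b \<sigma>)
    (mod_L \<mu> \<nu> t b \<sigma> ` (border_scheme_ideal n \<mu> \<nu> t b :: ('k::field) mpoly set))"
proof -
  let ?A = "generic_mult_mat \<mu> \<nu> t b :: nat \<Rightarrow> 'k mpoly mat"
  let ?T = "c_vars \<mu> \<nu>" and ?S = "S_vars \<mu> \<nu> t b \<sigma>" and ?w = "coefficient_weight V t b"
  define G where "G = {(?A k * ?A l - ?A l * ?A k) $$ (i, j)
      | k l i j. k < l \<and> l < n \<and> i < \<mu> \<and> j < \<mu>}"
  have G: "G \<subseteq> carrier (polys ?T)"
    unfolding G_def by (rule border_scheme_generators_closed[OF bij])
  have S: "?T - (?T - ?S) = ?S" by (auto simp: S_vars_def c_vars_def)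
  have image: "mod_L \<mu> \<nu> t b \<sigma> ` border_scheme_ideal n \<mu> \<nu> t b = Idl\<^bsub>polys ?S\<^esub> (mod_L \<mu> \<nu> t b \<sigma> ` G)"
    unfolding border_scheme_ideal_generators G_def[symmetric] mod_L_def
    using set_zero_genideal[OF G, of "?T - ?S"] unfolding S .
  have G': "mod_L \<mu> \<nu> t b \<sigma> ` G \<subseteq> carrier (polys ?S)"
    unfolding mod_L_def using G set_zero_closed[of _ ?T "?T - ?S"] unfolding S by blast
  have prod: "homogeneous_poly ?w
      (int (V k) + int (V l) + int (term_degree V (t j)) - int (term_degree V (t i)))
      (mod_L \<mu> \<nu> t b \<sigma> (\<Sum>m<\<mu>. ?A k $$ (i, m) * ?A l $$ (m, j)))"
    if "k < n" "l < n" "i < \<mu>" "j < \<mu>" for k l i j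
    unfolding mod_L_def set_zero_sum set_zero_mult
  proof (rule homogeneous_poly_sum)
    fix m assume "m \<in> {..<\<mu>}"
    then have m: "m < \<mu>" by simp
    have entry: "homogeneous_poly ?w
        (int (V k) + int (term_degree V (t j)) - int (term_degree V (t i)))
        (set_zero (?T - ?S) (?A k $$ (i, j)))" if "k < n" "i < \<mu>" "j < \<mu>" for k i j
      using mod_L_generic_mult_mat_homogeneous[OF bij that le] unfolding mod_L_def .
    show "homogeneous_poly ?w
      (int (V k) + int (V l) + int (term_degree V (t j)) - int (term_degree V (t i)))
      (set_zero (?T - ?S) (?A k $$ (i, m)) * set_zero (?T - ?S) (?A l $$ (m, j)))"
      using homogeneous_poly_mult[OF entry[OF that(1,3) m] entry[OF that(2) m that(4)]]
      by (simp add: algebra_simps)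
  qed
  have hom: "\<exists>D. homogeneous_poly ?w D g" if "g \<in> mod_L \<mu> \<nu> t b \<sigma> ` G" for g
  proof -
    obtain k l i j where *: "k < l" "l < n" "i < \<mu>" "j < \<mu>"
      "g = mod_L \<mu> \<nu> t b \<sigma> ((?A k * ?A l - ?A l * ?A k) $$ (i, j))"
    proof -
      obtain g' where g': "g' \<in> G" "g = mod_L \<mu> \<nu> t b \<sigma> g'" using \<open>g \<in> _\<close> by (rule imageE)
      from g'(1) obtain k l i j where "k < l" "l < n" "i < \<mu>" "j < \<mu>"
        "g' = (?A k * ?A l - ?A l * ?A k) $$ (i, j)"
        unfolding G_def mem_Collect_eq by (elim exE conjE)
      then show ?thesis using that g'(2) by simp
    qed
    have "homogeneous_poly ?w
      (int (V k) + int (V l) + int (term_degree V (t j)) - int (term_degree V (t i))) g"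
      unfolding *(5) generic_commutator_entry[OF *(3,4)] mod_L_def set_zero_diff
      using prod[of k l i j] prod[of l k i j] *(1-4) unfolding mod_L_def add.commute[of "int (V l)"]
      by (intro homogeneous_poly_diff) auto
    then show ?thesis ..
  qed
  have "hom_component ?w d g \<in> Idl\<^bsub>polys ?S\<^esub> (mod_L \<mu> \<nu> t b \<sigma> ` G)"
    if g: "g \<in> mod_L \<mu> \<nu> t b \<sigma> ` G" for g d
  proof -
    obtain D where "homogeneous_poly ?w D g" using hom[OF g] by blast
    then have "hom_component ?w d g \<in> {0, g}" by (simp add: hom_component_homogeneous_poly)
    then show ?thesis
      using subsetD[OF genideal_polys_self[OF G'] g] genideal_polys_ideal[OF G']
      by (auto simp: ideal_polys_iff)
  qed
  then show ?thesis unfolding image by (rule homogeneous_genideal[OF G'])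
qed

text \<open>
  This replaces the sum with the ideal generated by the \<open>c\<^sub>i\<^sub>j\<close> outside \<open>S\<^sub>O\<^sub>,\<^sub>\<sigma>\<close>, indeterminates for which
  no positive weight is at hand, by an ideal in which they do not occur.
\<close>

lemma groebner_scheme_ideal_eq:
  assumes "bij_betw t {..<\<mu>} Ord" "bij_betw b {..<\<nu>} (border n Ord)" "\<eta> \<le> \<nu>"
  shows "groebner_scheme_ideal n \<mu> \<nu> \<eta> t b \<sigma>
    = mod_L \<mu> \<nu> t b \<sigma> ` border_scheme_ideal n \<mu> \<nu> t b \<inter> carrier (polys (S_vars \<mu> \<eta> t b \<sigma>))"
proof -
  let ?T = "c_vars \<mu> \<nu>" and ?S = "S_vars \<mu> \<nu> t b \<sigma>"
  have S: "?T - (?T - ?S) = ?S" by (auto simp: S_vars_def c_vars_def)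
  have "S_vars \<mu> \<eta> t b \<sigma> \<subseteq> ?S" using assms(3) by (auto simp: S_vars_def)
  note mono = polys_mono[OF this]
  show ?thesis
    using mono variable_ideal_sum_contraction[OF Diff_subset[of ?T ?S]
      border_scheme_ideal_is_ideal[OF assms(1,2)]]
    unfolding groebner_scheme_ideal_def L_ideal_def mod_L_def S by blast
qed

theorem theorem2p8:
  fixes n \<mu> \<nu> \<eta> :: nat
    and Ord :: "pp set"
    and t b :: "nat \<Rightarrow> pp"
    and \<sigma> :: "pp rel"
  assumes "n \<ge> 1"
    and "order_ideal n Ord"
    and "bij_betw t {..<\<mu>} Ord"
    and "bij_betw b {..<\<nu>} (border n Ord)"
    and "\<eta> \<le> \<nu>"
    and "b ` {..<\<eta>} = corners n Ord"
    and "term_ordering n \<sigma>"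
  shows "\<exists>(W :: indet \<Rightarrow> nat) (Wbar :: indet \<Rightarrow> nat) (V :: nat \<Rightarrow> nat).
      (\<forall>v \<in> S_vars \<mu> \<eta> t b \<sigma>. 0 < W v) \<and>
      (\<forall>v \<in> S_vars \<mu> \<nu> t b \<sigma>. 0 < Wbar v) \<and>
      (\<forall>k<n. 0 < V k) \<and>
      (\<forall>v \<in> S_vars \<mu> \<eta> t b \<sigma>. Wbar v = W v) \<and>
      homogeneous_ideal W (S_vars \<mu> \<eta> t b \<sigma>)
        (groebner_scheme_ideal n \<mu> \<nu> \<eta> t b \<sigma> :: ('k::field) mpoly set) \<and>
      homogeneous_ideal (joint_weights V W) (x_vars n \<union> S_vars \<mu> \<eta> t b \<sigma>)
        (extend_add (x_vars n \<union> S_vars \<mu> \<eta> t b \<sigma>)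
           (groebner_scheme_ideal n \<mu> \<nu> \<eta> t b \<sigma> :: 'k mpoly set)
           (g_star \<mu> t b \<sigma> ` {..<\<eta>})) \<and>
      homogeneous_ideal Wbar (S_vars \<mu> \<nu> t b \<sigma>)
        (mod_L \<mu> \<nu> t b \<sigma> ` (border_scheme_ideal n \<mu> \<nu> t b :: 'k mpoly set)) \<and>
      homogeneous_ideal (joint_weights V Wbar) (x_vars n \<union> S_vars \<mu> \<nu> t b \<sigma>)
        (mod_L \<mu> \<nu> t b \<sigma> `
           extend_add (x_vars n \<union> c_vars \<mu> \<nu>)
             (border_scheme_ideal n \<mu> \<nu> t b :: 'k mpoly set)
             (g_star \<mu> t b \<sigma> ` {..<\<nu>}))"
proof -
  note t = \<open>bij_betw t {..<\<mu>} Ord\<close> and b = \<open>bij_betw b {..<\<nu>} (border n Ord)\<close>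
  note \<eta> = \<open>\<eta> \<le> \<nu>\<close>
  have Ord_terms: "Ord \<subseteq> terms n" using assms(2) by (simp add: order_ideal_def)
  have t_terms: "t i \<in> terms n" if "i < \<mu>" for i
    using bij_betw_imp_surj_on[OF t] that Ord_terms by blast
  have "border n Ord \<subseteq> terms n"
    using Ord_terms terms_add[OF xterm_in_terms] by (auto simp: border_def)
  then have b_terms: "b j \<in> terms n" if "j < \<nu>" for j
    using bij_betw_imp_surj_on[OF b] that by blast
  define E where "E = {(t i, b j) | i j. i < \<mu> \<and> j < \<nu> \<and> term_less \<sigma> (t i) (b j)}"
  have "E \<subseteq> t ` {..<\<mu>} \<times> b ` {..<\<nu>}" by (auto simp: E_def)
  then have "finite E" by (rule finite_subset) simp
  then have "\<exists>V. (\<forall>k<n. 0 < V k) \<and> (\<forall>(s, s')\<in>E. term_degree V s < term_degree V s')"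
    by (rule term_ordering_weights[OF assms(7)]) (use t_terms b_terms in \<open>auto simp: E_def\<close>)
  then obtain V where V: "\<forall>k<n. 0 < V k"
    and VE: "\<forall>(s, s')\<in>E. term_degree V s < term_degree V s'"
    by (elim exE conjE)
  have less: "term_degree V (t i) < term_degree V (b j)"
    if "i < \<mu>" "j < \<nu>" "term_less \<sigma> (t i) (b j)" for i j
    using VE that by (auto simp: E_def)
  then have le: "term_degree V (t i) \<le> term_degree V (b j)"
    if "i < \<mu>" "j < \<nu>" "term_less \<sigma> (t i) (b j)" for i j
    using that by (simp add: less_imp_le)
  let ?W = "coefficient_weight V t b" and ?w = "joint_weights V (coefficient_weight V t b)"
  let ?S = "S_vars \<mu> \<nu> t b \<sigma>" and ?Sc = "S_vars \<mu> \<eta> t b \<sigma>"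
  let ?IB = "border_scheme_ideal n \<mu> \<nu> t b :: 'k mpoly set"
  let ?IG = "groebner_scheme_ideal n \<mu> \<nu> \<eta> t b \<sigma> :: 'k mpoly set"
  have Sc: "?Sc \<subseteq> ?S" using \<eta> by (auto simp: S_vars_def)
  have pos: "0 < ?W v" if "v \<in> ?S" for v
    using that less by (auto simp: S_vars_def coefficient_weight_def)
  have agree: "?w v = ?W v" if "v \<in> ?S" for v
    using that by (auto simp: S_vars_def joint_weights_def)
  have d: "homogeneous_ideal ?W ?S (mod_L \<mu> \<nu> t b \<sigma> ` ?IB)"
    by (rule mod_L_border_scheme_ideal_homogeneous[OF t b le])
  have b': "homogeneous_ideal ?W ?Sc ?IG"
    unfolding groebner_scheme_ideal_eq[OF t b \<eta>] by (rule homogeneous_contraction[OF d Sc])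
  have g_hom: "\<exists>D. homogeneous_poly ?w D (g_star \<mu> t b \<sigma> j :: 'k mpoly)" if "j < \<nu>" for j
    using g_star_homogeneous[of \<mu> \<sigma> t b j V] le that by blast
  have g_closed: "(g_star \<mu> t b \<sigma> j :: 'k mpoly) \<in> carrier (polys (x_vars n \<union> S_vars \<mu> N t b \<sigma>))"
    if "j < N" "N \<le> \<nu>" for j N
    using that b_terms t_terms by (intro g_star_closed) auto
  have c: "homogeneous_ideal ?w (x_vars n \<union> ?Sc)
      (extend_add (x_vars n \<union> ?Sc) ?IG (g_star \<mu> t b \<sigma> ` {..<\<eta>}))"
    by (rule homogeneous_extend_add[OF b']) (use agree Sc g_hom g_closed \<eta> in auto)
  have "homogeneous_ideal ?w (x_vars n \<union> ?S)
      (extend_add (x_vars n \<union> ?S) (mod_L \<mu> \<nu> t b \<sigma> ` ?IB) (g_star \<mu> t b \<sigma> ` {..<\<nu>}))"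
    by (rule homogeneous_extend_add[OF d]) (use agree g_hom g_closed in auto)
  moreover have "mod_L \<mu> \<nu> t b \<sigma> ` extend_add (x_vars n \<union> c_vars \<mu> \<nu>) ?IB (g_star \<mu> t b \<sigma> ` {..<\<nu>})
      = extend_add (x_vars n \<union> ?S) (mod_L \<mu> \<nu> t b \<sigma> ` ?IB) (g_star \<mu> t b \<sigma> ` {..<\<nu>})"
  proof -
    let ?T = "x_vars n \<union> c_vars \<mu> \<nu>" and ?Z = "c_vars \<mu> \<nu> - ?S"
    have T: "?T - ?Z = x_vars n \<union> ?S" by (auto simp: x_vars_def c_vars_def S_vars_def)
    have "ideal ?IB (polys (c_vars \<mu> \<nu>))" by (rule border_scheme_ideal_is_ideal[OF t b])
    then have "?IB \<subseteq> carrier (polys (c_vars \<mu> \<nu>))" by (simp add: ideal_polys_iff)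
    then have IB: "?IB \<subseteq> carrier (polys ?T)" using polys_mono[of "c_vars \<mu> \<nu>" ?T] by blast
    have "set_zero ?Z (g_star \<mu> t b \<sigma> j) = (g_star \<mu> t b \<sigma> j :: 'k mpoly)" if "j < \<nu>" for j
      using g_closed[OF that] by (intro set_zero_id[of _ ?T]) (simp add: T)
    then have fixed: "set_zero ?Z ` g_star \<mu> t b \<sigma> ` {..<\<nu>} = (g_star \<mu> t b \<sigma> ` {..<\<nu>} :: 'k mpoly set)"
      by (auto simp: image_image)
    have "x_vars n \<union> ?S \<subseteq> ?T" by (auto simp: c_vars_def S_vars_def)
    from polys_mono[OF this]
    have G: "g_star \<mu> t b \<sigma> ` {..<\<nu>} \<subseteq> carrier (polys ?T :: 'k mpoly ring)"
      using g_closed by blast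
    show ?thesis
      using set_zero_extend_add[OF IB G, of ?Z] unfolding mod_L_def T fixed .
  qed
  ultimately have e: "homogeneous_ideal ?w (x_vars n \<union> ?S)
      (mod_L \<mu> \<nu> t b \<sigma> ` extend_add (x_vars n \<union> c_vars \<mu> \<nu>) ?IB (g_star \<mu> t b \<sigma> ` {..<\<nu>}))"
    by simp
  show ?thesis
    by (intro exI[of _ ?W] exI[of _ V] conjI ballI allI impI refl)
      (use pos Sc V b' c d e in auto)
qed

end
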